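(* Let $w_1<w_2$ and let $\frac{b(U,w)}{a(U,w)}$ be of class $C^1$ in the rectangle $R=\{w_1\le w\le w_2,\ u_1\le U\le u_2\}$. Assume that $a>0$ and $b>0$ in $R$, and that there exist two functions $q(w),p(w)\in L^1(w_1,w_2)$ such that $$0\le p(w)\le \frac{b(U,w)}{a(U,w)}\le q(w),\qquad \int_{w_1}^{w_2}p(t)\,dt>0.$$ Then the problem $$\nabla\cdot(a(u,w)\nabla u)=0\ \text{in }\Omega,\quad u=u_1\ \text{on }\Gamma_1,\quad u=u_2\ \text{on }\Gamma_2,\quad \frac{\partial u}{\partial n}=0\ \text{on }\Gamma_3,$$ $$\nabla\cdot(b(u,w)\nabla w)=0\ \text{in }\Omega,\quad w=w_1\ \text{on }\Gamma_1,\quad w=w_2\ \text{on }\Gamma_2,\quad \frac{\partial w}{\partial n}=0\ \text{on }\Gamma_3$$ has at least one functional solution. Moreover, if $\frac{b(U,w)}{a(U,w)}$ satisfies a Lipschitz condition in $R$ with respect to $U$, the solution of this problem is unique in the class of functional solutions.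
   Context: $\Omega$ is an open and bounded subset of $\mathbf{R}^N$ with boundary $\Gamma$ divided into three parts $\Gamma_1,\Gamma_2,\Gamma_3$, and $\partial/\partial n$ is the normal derivative; $u_1,u_2,w_1,w_2$ are constants. The boundary of $\Omega$ is assumed to have a degree of regularity which makes solvable the mixed problem $\Delta z=0$ in $\Omega$, $z=0$ on $\Gamma_1$, $z=1$ on $\Gamma_2$, $\frac{\partial z}{\partial n}=0$ on $\Gamma_3$. A classical solution $(u(\mathbf{x}),w(\mathbf{x}))$ of the system is called functional if a function $U(t)\in C^1([w_1,w_2])$ exists such that $u(\mathbf{x})=U(w(\mathbf{x}))$.
   Formalization: Solvability of the mixed problem is taken as unique solvability (uniqueness fails if a component of Ω is bounded only by Γ3), and a, b are assumed continuous on R (with a=b discontinuous a classical solution may not exist); solutions take values in R. *)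

theory Defs
  imports "HOL-Analysis.Analysis"
begin

(* On an open set the within-derivative is the usual derivative; on an interval or a rectangle
   it is the one-sided derivative at boundary points. *)
definition C1_on :: "('a::real_normed_vector \<Rightarrow> 'b::real_normed_vector) \<Rightarrow> 'a set \<Rightarrow> bool" where
  "C1_on f S \<longleftrightarrow>
     (\<exists>D. (\<forall>x\<in>S. (f has_derivative blinfun_apply (D x)) (at x within S)) \<and> continuous_on S D)"

definition grad :: "('a::euclidean_space \<Rightarrow> real) \<Rightarrow> 'a \<Rightarrow> 'a" where
  "grad f x = (\<Sum>i\<in>Basis. frechet_derivative f (at x) i *\<^sub>R i)"

definition divergence :: "('a::euclidean_space \<Rightarrow> 'a) \<Rightarrow> 'a \<Rightarrow> real" where
  "divergence V x = (\<Sum>i\<in>Basis. frechet_derivative V (at x) i \<bullet> i)"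

(* Near x the boundary is a C^1 hypersurface with \<Omega> on one side of it; \<phi> is a local defining
   function, negative inside \<Omega>. *)
definition outward_unit_normal :: "'a::euclidean_space set \<Rightarrow> 'a \<Rightarrow> 'a \<Rightarrow> bool" where
  "outward_unit_normal \<Omega> x n \<longleftrightarrow>
     x \<in> frontier \<Omega> \<and>
     (\<exists>V \<phi>. open V \<and> x \<in> V \<and> C1_on \<phi> V \<and> (\<forall>y\<in>V. grad \<phi> y \<noteq> 0) \<and>
        \<Omega> \<inter> V = {y\<in>V. \<phi> y < 0} \<and> frontier \<Omega> \<inter> V = {y\<in>V. \<phi> y = 0} \<and>
        n = sgn (grad \<phi> x))"

(* The point x + t n lies in \<Omega> for small t < 0, so only values of f on closure \<Omega> enter. *)
definition has_normal_derivative :: "'a::euclidean_space set \<Rightarrow> ('a \<Rightarrow> real) \<Rightarrow> real \<Rightarrow> 'a \<Rightarrow> bool" where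
  "has_normal_derivative \<Omega> f d x \<longleftrightarrow>
     (\<exists>n. outward_unit_normal \<Omega> x n \<and>
          ((\<lambda>t. f (x + t *\<^sub>R n)) has_real_derivative d) (at_left 0))"

(* v is a classical solution of div (k grad v) = 0 in \<Omega>, v = c1 on \<Gamma>1, v = c2 on \<Gamma>2,
   dv/dn = 0 on \<Gamma>3.  The regularity asked for is what the divergence form needs: v and the flux
   k grad v are of class C^1 in \<Omega>.  If k is a positive C^1 function of C^1 solutions, and in
   particular if k = 1, this amounts to v being of class C^2 in \<Omega>. *)
definition mixed_bvp ::
  "'a::euclidean_space set \<Rightarrow> 'a set \<Rightarrow> 'a set \<Rightarrow> 'a set \<Rightarrow> ('a \<Rightarrow> real) \<Rightarrow> real \<Rightarrow> real \<Rightarrow> ('a \<Rightarrow> real) \<Rightarrow> bool"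
where
  "mixed_bvp \<Omega> \<Gamma>1 \<Gamma>2 \<Gamma>3 k c1 c2 v \<longleftrightarrow>
     continuous_on (closure \<Omega>) v \<and> C1_on v \<Omega> \<and>
     C1_on (\<lambda>x. k x *\<^sub>R grad v x) \<Omega> \<and>
     (\<forall>x\<in>\<Omega>. divergence (\<lambda>y. k y *\<^sub>R grad v y) x = 0) \<and>
     (\<forall>x\<in>\<Gamma>1. v x = c1) \<and> (\<forall>x\<in>\<Gamma>2. v x = c2) \<and>
     (\<forall>x\<in>\<Gamma>3. has_normal_derivative \<Omega> v 0 x)"

(* Solvability of the mixed problem for the Laplacian is read as well-posedness: there is one and
   only one solution on closure \<Omega> (values elsewhere are irrelevant).  Uniqueness excludes, e.g.,
   a connected component of \<Omega> whose boundary lies entirely in \<Gamma>3. *)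
definition mixed_problem_solvable ::
  "'a::euclidean_space set \<Rightarrow> 'a set \<Rightarrow> 'a set \<Rightarrow> 'a set \<Rightarrow> bool"
where
  "mixed_problem_solvable \<Omega> \<Gamma>1 \<Gamma>2 \<Gamma>3 \<longleftrightarrow>
     (\<exists>z. mixed_bvp \<Omega> \<Gamma>1 \<Gamma>2 \<Gamma>3 (\<lambda>x. 1) 0 1 z) \<and>
     (\<forall>z z'. mixed_bvp \<Omega> \<Gamma>1 \<Gamma>2 \<Gamma>3 (\<lambda>x. 1) 0 1 z \<longrightarrow>
             mixed_bvp \<Omega> \<Gamma>1 \<Gamma>2 \<Gamma>3 (\<lambda>x. 1) 0 1 z' \<longrightarrow> (\<forall>x\<in>closure \<Omega>. z x = z' x))"

(* The coefficients a and b matter only on the rectangle [u1,u2] x [w1,w2], so a solution has to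
   take its values there. *)
definition classical_solution ::
  "'a::euclidean_space set \<Rightarrow> 'a set \<Rightarrow> 'a set \<Rightarrow> 'a set \<Rightarrow>
   (real \<Rightarrow> real \<Rightarrow> real) \<Rightarrow> (real \<Rightarrow> real \<Rightarrow> real) \<Rightarrow> real \<Rightarrow> real \<Rightarrow> real \<Rightarrow> real \<Rightarrow>
   ('a \<Rightarrow> real) \<Rightarrow> ('a \<Rightarrow> real) \<Rightarrow> bool"
where
  "classical_solution \<Omega> \<Gamma>1 \<Gamma>2 \<Gamma>3 a b u1 u2 w1 w2 u w \<longleftrightarrow>
     (\<forall>x\<in>closure \<Omega>. u x \<in> {u1..u2} \<and> w x \<in> {w1..w2}) \<and>
     mixed_bvp \<Omega> \<Gamma>1 \<Gamma>2 \<Gamma>3 (\<lambda>x. a (u x) (w x)) u1 u2 u \<and>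
     mixed_bvp \<Omega> \<Gamma>1 \<Gamma>2 \<Gamma>3 (\<lambda>x. b (u x) (w x)) w1 w2 w"

definition functional_solution ::
  "'a::euclidean_space set \<Rightarrow> 'a set \<Rightarrow> 'a set \<Rightarrow> 'a set \<Rightarrow>
   (real \<Rightarrow> real \<Rightarrow> real) \<Rightarrow> (real \<Rightarrow> real \<Rightarrow> real) \<Rightarrow> real \<Rightarrow> real \<Rightarrow> real \<Rightarrow> real \<Rightarrow>
   ('a \<Rightarrow> real) \<Rightarrow> ('a \<Rightarrow> real) \<Rightarrow> bool"
where
  "functional_solution \<Omega> \<Gamma>1 \<Gamma>2 \<Gamma>3 a b u1 u2 w1 w2 u w \<longleftrightarrow>
     classical_solution \<Omega> \<Gamma>1 \<Gamma>2 \<Gamma>3 a b u1 u2 w1 w2 u w \<and>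
     (\<exists>U. C1_on U {w1..w2} \<and> (\<forall>x\<in>closure \<Omega>. u x = U (w x)))"

end

theory Submission
  imports Defs
begin

text \<open>Write c = b/a.  If u = U(w), then both Kirchhoff transforms of w, namely the integrals of
  b(U(t),t) and of a(U(t),t) U'(t), turn the two equations into the Laplace equation, so both are
  multiples of the solution z of the mixed problem; comparing them gives U' = g c(U,w) with a
  constant g.  Thus functional solutions correspond to solutions (g, U) of this two-point problem
  with U(w1) = u1 and U(w2) = u2.  Since c is bounded, bounded away from 0 and Lipschitz in U, a
  solution is found by shooting in g (the initial value problem is solved for all g at once by a
  contraction on functions of (g,w), so that continuity in g is automatic), and it is unique because
  the slope at a crossing point is monotone in g.

  Inverting the first transform needs z to take values in [0,1].  As the boundary is only of class
  C^1, Hopf's lemma is not available; instead z is compared near a boundary maximum with strictly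
  subharmonic quadratic barriers, and well-posedness of the mixed problem excludes components on
  which z is constant.\<close>

section \<open>A two-point boundary value problem for an ODE\<close>

text \<open>The coefficients live only on a rectangle and a profile \<open>U\<close> only on
  \<open>{w1..w2}\<close>, whereas the chain rule for normal derivatives needs outer functions with
  a two-sided derivative, also at the end values \<open>w1\<close> and \<open>w2\<close>. Such
  functions are therefore extended to the whole line by \<open>clip\<close>, the retraction onto an
  interval, which keeps continuity, bounds and Lipschitz constants. Uniqueness in the mixed problem
  is available only for the boundary values 0 and 1. The Kirchhoff transform of \<open>u\<close>
  cannot always be normalised to them, since its increment is zero for a constant profile; so a
  linear combination of both transforms with end values 0 and 1 is identified with z instead. A
  profile is constrained only on the range of \<open>w\<close>. If z omits a level in (0,1), the
  differential equation for \<open>U\<close> cannot be derived on the whole interval. But then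
  \<Omega> splits at that level, z could be replaced by constants on the pieces, and well-posedness
  leaves z only the values 0 and 1, so that \<open>w\<close> and \<open>u\<close> are known
  directly. This is the reason for the case distinction in the uniqueness proof.\<close>

definition clip :: "real \<Rightarrow> real \<Rightarrow> real \<Rightarrow> real" where
  "clip l r t = max l (min r t)"

lemma clip_in: "l \<le> r \<Longrightarrow> clip l r t \<in> {l..r}"
  by (auto simp: clip_def)

lemma clip_id: "t \<in> {l..r} \<Longrightarrow> clip l r t = t"
  by (auto simp: clip_def)

lemma continuous_on_clip [continuous_intros]:
  "continuous_on S f \<Longrightarrow> continuous_on S (\<lambda>x. clip l r (f x))"
  unfolding clip_def by (intro continuous_intros)

lemma clip_lipschitz: "\<bar>clip l r s - clip l r t\<bar> \<le> \<bar>s - t\<bar>"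
  by (auto simp: clip_def max_def min_def)

section \<open>Antiderivatives on the whole line and their inverses\<close>

lemma continuous_antiderivative:
  fixes f :: "real \<Rightarrow> real"
  assumes "continuous_on UNIV f"
  obtains F where "\<And>x. (F has_real_derivative f x) (at x)" "F c = d"
proof -
  have "\<exists>F. \<forall>x::real. (-\<infinity>::ereal) < x \<longrightarrow> x < (\<infinity>::ereal) \<longrightarrow> (F has_vector_derivative f x) (at x)"
    by (rule einterval_antiderivative)
      (use assms in \<open>auto simp: continuous_on_eq_continuous_at\<close>)
  then obtain F where F: "\<And>x. (F has_real_derivative f x) (at x)"
    by (auto simp: has_real_derivative_iff_has_vector_derivative)
  show ?thesis
    by (rule that[of "\<lambda>x. F x - F c + d"]) (auto intro!: derivative_eq_intros F)
qed

lemma derivative_lower_bound: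
  fixes F f :: "real \<Rightarrow> real"
  assumes F: "\<And>x. (F has_real_derivative f x) (at x)" and m: "\<And>x. m \<le> f x" and "x \<le> y"
  shows "m * (y - x) \<le> F y - F x"
proof (cases "x = y")
  case False
  with \<open>x \<le> y\<close> have "x < y" by simp
  then obtain t where "F y - F x = (y - x) * f t"
    using MVT2[of x y F f] F by blast
  with m[of t] \<open>x \<le> y\<close> show ?thesis
    by (simp add: mult.commute mult_right_mono)
qed simp

text \<open>The bound \<open>m\<close> on the slope makes \<open>F\<close> injective and coercive,
  hence a bijection of the line. It also makes \<open>G\<close> Lipschitz with constant 1/m, which
  supplies the continuity required by the inverse function rule.\<close>

lemma antiderivative_inverse:
  fixes F f :: "real \<Rightarrow> real"
  assumes F: "\<And>x. (F has_real_derivative f x) (at x)" and m: "\<And>x. m \<le> f x" "m > 0"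
  obtains G where "\<And>y. F (G y) = y" "\<And>x. G (F x) = x"
    "\<And>y. (G has_real_derivative inverse (f (G y))) (at y)"
proof -
  note lower = derivative_lower_bound[of F f m, OF F m(1)]
  have cont: "continuous_on S F" for S
    using F by (meson DERIV_isCont continuous_at_imp_continuous_on)
  have inj: "inj F"
  proof (rule linorder_injI)
    fix x y :: real assume "x < y"
    then have "m * (y - x) > 0" using m(2) by simp
    with lower[of x y] \<open>x < y\<close> show "F x \<noteq> F y" by linarith
  qed
  have surj: "\<exists>x. F x = y" for y
  proof -
    \<comment> \<open>Chosen so that \<open>m * R\<close> is the distance from \<open>F 0\<close> to
      \<open>y\<close>: moving by \<open>R\<close> in either direction carries \<open>F\<close> at
      least as far as \<open>y\<close>.\<close>
    define R where "R = \<bar>y - F 0\<bar> / m"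
    have R: "R \<ge> 0" "m * R = \<bar>y - F 0\<bar>" using m(2) by (auto simp: R_def)
    have "F (- R) \<le> y" "y \<le> F R"
      using lower[of "-R" 0] lower[of 0 R] R by auto
    then show ?thesis
      using IVT'[of F "-R" y R] R cont by auto
  qed
  define G where "G = inv F"
  have FG: "F (G y) = y" for y
    unfolding G_def using surj by (metis f_inv_into_f rangeI)
  have GF: "G (F x) = x" for x
    unfolding G_def using inj by simp
  have lip: "m * \<bar>G y - G y'\<bar> \<le> \<bar>y - y'\<bar>" for y y'
    using lower[of "G y" "G y'"] lower[of "G y'" "G y"] unfolding FG
    by (cases "G y \<le> G y'") auto
  have "(1 / m)-lipschitz_on UNIV G"
    using m(2) lip by (intro lipschitz_onI) (auto simp: dist_real_def field_simps)
  then have "continuous_on UNIV G" by (rule lipschitz_on_continuous_on)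
  then have contG: "isCont G y" for y by (simp add: continuous_on_eq_continuous_at)
  have "(G has_real_derivative inverse (f (G y))) (at y)" for y
  proof (rule DERIV_inverse_function[where f = F and a = "y - 1" and b = "y + 1"])
    show "f (G y) \<noteq> 0" using m(1)[of "G y"] m(2) by linarith
  qed (use F contG FG in auto)
  with that FG GF show ?thesis by blast
qed

text \<open>The substitution t = c + r (s - c) moves the variable end point into the integrand, so
  continuity of integrals over the fixed interval [0,1] with respect to a parameter applies. The
  restriction to s at least c matters, because the integral over an empty interval is 0 and the
  substituted formula fails there.\<close>

lemma continuous_on_integral_upper:
  fixes f :: "'a::topological_space \<Rightarrow> real \<Rightarrow> real"
  assumes f: "continuous_on UNIV (\<lambda>(x, t). f x t)"
  shows "continuous_on (UNIV \<times> {c..}) (\<lambda>(x, s). integral {c..s} (f x))"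
proof -
  have eq: "integral {c..s} (f x) = (s - c) * integral (cbox 0 1) (\<lambda>r. f x (c + r * (s - c)))"
    if "c \<le> s" for x s
  proof -
    have cont: "continuous_on {c..s} (f x)"
      using continuous_on_compose2[OF f, of "{c..s}" "\<lambda>t. (x, t)"]
        continuous_on_Pair[OF continuous_on_const continuous_on_id, of "{c..s}" x] by simp
    have "((\<lambda>r. (s - c) *\<^sub>R f x (c + r * (s - c))) has_integral
        (integral {c + 0 * (s - c)..c + 1 * (s - c)} (f x))) {0..1}"
    proof (rule has_integral_substitution[where c = c and d = s])
      show "(\<lambda>r. c + r * (s - c)) ` {0..1} \<subseteq> {c..s}"
      proof clarify
        fix r :: real assume "r \<in> {0..1}"
        then have "0 \<le> r * (s - c)" "r * (s - c) \<le> 1 * (s - c)"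
          using that by (intro mult_nonneg_nonneg mult_right_mono; simp)+
        then show "c + r * (s - c) \<in> {c..s}" by simp
      qed
      show "((\<lambda>r. c + r * (s - c)) has_real_derivative s - c) (at r within {0..1})" for r
        by (auto intro!: derivative_eq_intros)
    qed (use that cont in auto)
    then have "integral {0..1} (\<lambda>r. (s - c) *\<^sub>R f x (c + r * (s - c))) = integral {c..s} (f x)"
      by (simp only: integral_unique) simp
    then show ?thesis by (simp del: real_scaleR_def) simp
  qed
  have "continuous_on (UNIV \<times> {c..}) (\<lambda>p. integral (cbox 0 1) (\<lambda>r. f (fst p) (c + r * (snd p - c))))"
  proof (rule integral_continuous_on_param)
    have "continuous_on ((UNIV \<times> {c..}) \<times> cbox 0 1)
       (\<lambda>q. (\<lambda>(x, t). f x t) (fst (fst q), c + snd q * (snd (fst q) - c)))"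
      by (rule continuous_on_compose2[OF f]) (auto intro!: continuous_intros)
    then show "continuous_on ((UNIV \<times> {c..}) \<times> cbox 0 1)
       (\<lambda>(p, r). f (fst p) (c + r * (snd p - c)))"
      by (simp add: case_prod_unfold)
  qed
  then have "continuous_on (UNIV \<times> {c..})
      (\<lambda>p. (snd p - c) * integral (cbox 0 1) (\<lambda>r. f (fst p) (c + r * (snd p - c))))"
    by (intro continuous_intros)
  then show ?thesis
    by (rule continuous_on_eq) (auto simp: eq)
qed

text \<open>Picard's operator acts on functions of the pair (g,t), and the exponential weight
  \<open>e\<close> (Bielecki's norm) makes it a contraction on the whole interval at once, whatever
  its length. The fixed point is sought as X = Y / e in the space of bounded continuous functions on
  the plane, so joint continuity in (g,t) comes with it.\<close>

lemma ode_family: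
  fixes c :: "real \<Rightarrow> real \<Rightarrow> real"
  assumes c: "continuous_on UNIV (\<lambda>(U, t). c U t)"
    and bound: "\<And>U t. \<bar>c U t\<bar> \<le> K"
    and lip: "\<And>U V t. \<bar>c U t - c V t\<bar> \<le> L * \<bar>U - V\<bar>"
    and "0 \<le> L" "0 \<le> G" "r \<le> s"
  obtains Y where "continuous_on UNIV (\<lambda>(g, t). Y g t)"
    "\<And>g t. g \<in> {0..G} \<Longrightarrow> t \<in> {r..s} \<Longrightarrow> Y g t = y0 + g * integral {r..t} (\<lambda>\<tau>. c (Y g \<tau>) \<tau>)"
proof -
  \<comment> \<open>The integral of \<open>e\<close> gains a factor 1/l, so this rate gives the
    contraction constant \<open>G * L / l\<close>, at most 1/2. The summand 1 keeps \<open>l\<close>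
    positive when \<open>G * L\<close> is 0.\<close>
  define l where "l = 2 * (G * L) + 1"
  have "G * L \<ge> 0" using \<open>0 \<le> L\<close> \<open>0 \<le> G\<close> by simp
  then have l: "l > 0" "G * L / l \<le> 1 / 2"
    by (simp_all add: l_def divide_le_eq)
  define e where "e t = exp (l * (t - r))" for t
  have e: "e t > 0" "r \<le> t \<Longrightarrow> e t \<ge> 1" for t
    using l by (auto simp: e_def)
  have conte [continuous_intros]: "continuous_on A (\<lambda>x. e (h x))"
    if "continuous_on A h" for A and h :: "real \<times> real \<Rightarrow> real"
    unfolding e_def by (intro continuous_intros that)
  \<comment> \<open>The integral equation divided by the weight. Clipping both arguments keeps the
    image bounded on the whole plane without changing the equation on the region of
    interest.\<close>
  define T where "T X p = (y0 + clip 0 G (fst p) *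
      integral {r..clip r s (snd p)} (\<lambda>\<tau>. c (e \<tau> * X (clip 0 G (fst p), \<tau>)) \<tau>)) / e (clip r s (snd p))"
    for X :: "real \<times> real \<Rightarrow> real" and p
  have contf: "continuous_on UNIV (\<lambda>(g, \<tau>). c (e \<tau> * X (g, \<tau>)) \<tau>)"
    if "continuous_on UNIV X" for X :: "real \<times> real \<Rightarrow> real"
  proof -
    have "continuous_on UNIV (\<lambda>p. (\<lambda>(U, t). c U t) (e (snd p) * X p, snd p))"
      by (rule continuous_on_compose2[OF c]) (auto intro!: continuous_intros that)
    then show ?thesis by (simp add: case_prod_unfold)
  qed
  have int: "(\<lambda>\<tau>. c (e \<tau> * X (g, \<tau>)) \<tau>) integrable_on {r..t}"
    if "continuous_on UNIV X" for X :: "real \<times> real \<Rightarrow> real" and g t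
    using continuous_on_compose2[OF contf[OF that], of "{r..t}" "\<lambda>t. (g, t)"]
      continuous_on_Pair[OF continuous_on_const continuous_on_id, of "{r..t}" g]
    by (intro integrable_continuous_interval) simp
  have clip: "r \<le> clip r s t" "clip r s t \<le> s" "0 \<le> clip 0 G t" "clip 0 G t \<le> G" for t
    using clip_in[OF \<open>r \<le> s\<close>, of t] clip_in[OF \<open>0 \<le> G\<close>, of t] by auto
  have T_bcont: "T X \<in> bcontfun" if X: "continuous_on UNIV X" for X
  proof (rule bcontfun_normI)
    have "continuous_on UNIV (\<lambda>p. (\<lambda>(g, t). integral {r..t} (\<lambda>\<tau>. c (e \<tau> * X (g, \<tau>)) \<tau>))
        (clip 0 G (fst p), clip r s (snd p)))"
      by (rule continuous_on_compose2[OF continuous_on_integral_upper[OF contf[OF X]]])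
        (auto intro!: continuous_intros simp: clip)
    then show "continuous_on UNIV (T X)"
      unfolding T_def using e by (auto intro!: continuous_intros simp: less_imp_neq[symmetric])
  next
    fix p
    let ?I = "integral {r..clip r s (snd p)} (\<lambda>\<tau>. c (e \<tau> * X (clip 0 G (fst p), \<tau>)) \<tau>)"
    have K: "K \<ge> 0" using bound[of 0 0] by linarith
    have "norm ?I \<le> integral {r..clip r s (snd p)} (\<lambda>_. K)"
      by (rule integral_norm_bound_integral[OF int[OF X]]) (use bound in auto)
    also have "\<dots> \<le> K * (s - r)"
      using clip K by (auto simp: mult.commute intro!: mult_left_mono)
    finally have "\<bar>clip 0 G (fst p) * ?I\<bar> \<le> G * (K * (s - r))"
      unfolding abs_mult using clip \<open>0 \<le> G\<close> by (intro mult_mono) auto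
    then have "\<bar>y0 + clip 0 G (fst p) * ?I\<bar> \<le> \<bar>y0\<bar> + G * (K * (s - r))" by linarith
    moreover have "norm (T X p) \<le> \<bar>y0 + clip 0 G (fst p) * ?I\<bar> / 1"
      unfolding T_def real_norm_def abs_divide
      by (rule divide_left_mono) (use e(2)[OF clip(1)[of "snd p"]] in auto)
    ultimately show "norm (T X p) \<le> \<bar>y0\<bar> + G * (K * (s - r))" by simp
  qed
  define TT where "TT X = Bcontfun (T (apply_bcontfun X))" for X
  have TT: "apply_bcontfun (TT X) = T (apply_bcontfun X)" for X
    unfolding TT_def by (rule Bcontfun_inverse, rule T_bcont) simp
  have "dist (TT X) (TT Z) \<le> 1 / 2 * dist X Z" for X Z
  proof (rule dist_bound)
    fix p :: "real \<times> real"
    let ?g = "clip 0 G (fst p)" and ?t = "clip r s (snd p)" and ?d = "dist X Z"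
    let ?f = "\<lambda>X \<tau>. c (e \<tau> * apply_bcontfun X (?g, \<tau>)) \<tau>"
    \<comment> \<open>The weight is its own antiderivative up to the factor \<open>l\<close>; this
      is where 1/l is gained.\<close>
    have hi: "((\<lambda>\<tau>. L * ?d * e \<tau>) has_integral L * ?d * e ?t / l - L * ?d * e r / l) {r..?t}"
    proof (rule fundamental_theorem_of_calculus)
      show "((\<lambda>\<tau>. L * ?d * e \<tau> / l) has_vector_derivative L * ?d * e \<tau>) (at \<tau> within {r..?t})" for \<tau>
        unfolding e_def has_real_derivative_iff_has_vector_derivative[symmetric]
        using l by (auto intro!: derivative_eq_intros)
    qed (use clip in auto)
    have "norm (integral {r..?t} (\<lambda>\<tau>. ?f X \<tau> - ?f Z \<tau>)) \<le> integral {r..?t} (\<lambda>\<tau>. L * ?d * e \<tau>)"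
    proof (rule integral_norm_bound_integral)
      fix \<tau>
      have "\<bar>?f X \<tau> - ?f Z \<tau>\<bar> \<le> L * \<bar>e \<tau> * (X (?g, \<tau>) - Z (?g, \<tau>))\<bar>"
        using lip by (simp add: right_diff_distrib)
      also have "\<dots> = L * (e \<tau> * dist (X (?g, \<tau>)) (Z (?g, \<tau>)))"
        using e(1)[of \<tau>] by (simp add: abs_mult dist_real_def)
      also have "\<dots> \<le> L * (e \<tau> * ?d)"
        using e(1)[of \<tau>] \<open>0 \<le> L\<close> by (intro mult_left_mono dist_bounded) auto
      finally show "norm (?f X \<tau> - ?f Z \<tau>) \<le> L * ?d * e \<tau>" by (simp add: ac_simps)
    qed (use hi int in \<open>auto intro!: integrable_diff\<close>)
    also have "\<dots> \<le> L * ?d * e ?t / l"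
      unfolding integral_unique[OF hi] using \<open>0 \<le> L\<close> e(1)[of r] l by simp
    finally have I: "\<bar>integral {r..?t} (?f X) - integral {r..?t} (?f Z)\<bar> \<le> L * ?d * e ?t / l"
      by (simp add: integral_diff[OF int int])
    have "dist (T X p) (T Z p) = ?g * \<bar>integral {r..?t} (?f X) - integral {r..?t} (?f Z)\<bar> / e ?t"
      unfolding T_def dist_real_def using clip(3)[of "fst p"] e(1)[of ?t]
      by (simp add: diff_divide_distrib[symmetric] abs_mult right_diff_distrib[symmetric])
    also have "\<dots> \<le> G * (L * ?d * e ?t / l) / e ?t"
      using clip e(1)[of ?t] I \<open>0 \<le> G\<close> by (intro divide_right_mono mult_mono) auto
    also have "\<dots> = G * L / l * ?d" using e(1)[of ?t] by simp
    also have "\<dots> \<le> 1 / 2 * ?d" using l by (intro mult_right_mono) auto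
    finally show "dist (TT X p) (TT Z p) \<le> 1 / 2 * ?d" by (simp add: TT)
  qed
  then obtain X where X: "TT X = X"
    using banach_fix_type[of "1 / 2" TT] by auto
  define Y where "Y g t = e t * X (g, t)" for g t
  have "continuous_on UNIV (\<lambda>(g, t). Y g t)"
    unfolding Y_def case_prod_unfold by (auto intro!: continuous_intros)
  moreover have "Y g t = y0 + g * integral {r..t} (\<lambda>\<tau>. c (Y g \<tau>) \<tau>)"
    if "g \<in> {0..G}" "t \<in> {r..s}" for g t
  proof -
    have "X (g, t) = T X (g, t)" using TT[of X] X by simp
    then show ?thesis
      using that e(1)[of t] by (simp add: T_def Y_def clip_id field_simps)
  qed
  ultimately show ?thesis using that by blast
qed

text \<open>Shooting in the factor \<open>g\<close>: for g = 0 the solution stays at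
  \<open>y0\<close>, for g = G it ends at or above \<open>y1\<close>, and its end value depends
  continuously on \<open>g\<close>.\<close>

lemma two_point_problem:
  fixes c :: "real \<Rightarrow> real \<Rightarrow> real"
  assumes c: "continuous_on UNIV (\<lambda>(U, t). c U t)"
    and m: "\<And>U t. m \<le> c U t" "0 < m"
    and bound: "\<And>U t. c U t \<le> K"
    and lip: "\<And>U V t. \<bar>c U t - c V t\<bar> \<le> L * \<bar>U - V\<bar>"
    and "0 \<le> L" "r < s" "y0 \<le> y1"
  obtains g U where "g \<ge> 0" "continuous_on {r..s} U" "U r = y0" "U s = y1"
    "\<And>t. t \<in> {r..s} \<Longrightarrow> (U has_real_derivative g * c (U t) t) (at t within {r..s})"
proof -
  \<comment> \<open>At this factor the slope is at least \<open>G * m\<close>, so the rise over the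
    interval is at least y1 - y0.\<close>
  define G where "G = (y1 - y0) / (m * (s - r))"
  have G: "0 \<le> G" "G * (m * (s - r)) = y1 - y0"
    using assms by (auto simp: G_def)
  have "\<bar>c U t\<bar> \<le> K" for U t using m(1)[of U t] m(2) bound[of U t] by linarith
  then obtain Y where contY: "continuous_on UNIV (\<lambda>(g, t). Y g t)"
    and Y: "\<And>g t. g \<in> {0..G} \<Longrightarrow> t \<in> {r..s} \<Longrightarrow> Y g t = y0 + g * integral {r..t} (\<lambda>\<tau>. c (Y g \<tau>) \<tau>)"
    using ode_family[OF c _ lip \<open>0 \<le> L\<close> G(1), of K r s y0] \<open>r < s\<close> by auto
  have contYt: "continuous_on A (Y g)" for A g
    using continuous_on_compose2[OF contY, of A "\<lambda>t. (g, t)"]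
      continuous_on_Pair[OF continuous_on_const continuous_on_id, of A g] by simp
  have contYg: "continuous_on A (\<lambda>g. Y g t)" for A t
    using continuous_on_compose2[OF contY, of A "\<lambda>g. (g, t)"]
      continuous_on_Pair[OF continuous_on_id continuous_on_const, of A t] by simp
  have contc: "continuous_on A (\<lambda>t. c (Y g t) t)" for A g
    using continuous_on_compose2[OF c, of A "\<lambda>t. (Y g t, t)"]
      continuous_on_Pair[OF contYt continuous_on_id, of A g] by simp
  have "Y 0 s \<le> y1" using Y[of 0 s] G \<open>r < s\<close> \<open>y0 \<le> y1\<close> by simp
  moreover have "y1 \<le> Y G s"
  proof -
    have "integral {r..s} (\<lambda>_. m) \<le> integral {r..s} (\<lambda>\<tau>. c (Y G \<tau>) \<tau>)"
      using m by (intro integral_le integrable_continuous_interval contc) auto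
    then have "G * (m * (s - r)) \<le> G * integral {r..s} (\<lambda>\<tau>. c (Y G \<tau>) \<tau>)"
      using \<open>r < s\<close> G(1) by (intro mult_left_mono) (auto simp: mult.commute)
    then show ?thesis using Y[of G s] G \<open>r < s\<close> by simp
  qed
  ultimately obtain g where g: "0 \<le> g" "g \<le> G" "Y g s = y1"
    using IVT'[of "\<lambda>g. Y g s" 0 y1 G] G(1) contYg by blast
  show ?thesis
  proof (rule that[of g "Y g"])
    show "Y g r = y0" using Y[of g r] g \<open>r < s\<close> by simp
    fix t assume t: "t \<in> {r..s}"
    have "((\<lambda>t. y0 + g * integral {r..t} (\<lambda>\<tau>. c (Y g \<tau>) \<tau>)) has_real_derivative g * c (Y g t) t)
        (at t within {r..s})"
      using integral_has_real_derivative[OF contc t] by (auto intro!: derivative_eq_intros)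
    then show "(Y g has_real_derivative g * c (Y g t) t) (at t within {r..s})"
      by (rule has_field_derivative_transform_within[OF _ zero_less_one t]) (use Y g in auto)
  qed (use g contYt in auto)
qed

text \<open>Gronwall's argument: the squared distance of the solutions, damped by an exponential, is
  nonincreasing, nonnegative, and 0 at the left end.\<close>

lemma ode_unique:
  fixes c :: "real \<Rightarrow> real \<Rightarrow> real"
  assumes U: "\<And>t. t \<in> {r..s} \<Longrightarrow> (U has_real_derivative g * c (U t) t) (at t within {r..s})"
    and V: "\<And>t. t \<in> {r..s} \<Longrightarrow> (V has_real_derivative g * c (V t) t) (at t within {r..s})"
    and lip: "\<And>t. t \<in> {r..s} \<Longrightarrow> \<bar>c (U t) t - c (V t) t\<bar> \<le> L * \<bar>U t - V t\<bar>"
    and "U r = V r" and t: "t \<in> {r..s}"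
  shows "U t = V t"
proof -
  \<comment> \<open>The rate at which the squared distance can grow at most. The absolute value is
    there because \<open>g\<close> may have either sign.\<close>
  define k where "k = 2 * \<bar>g\<bar> * L"
  define h where "h t = (U t - V t)\<^sup>2 * exp (- k * t)" for t
  define h' where "h' t = (2 * (U t - V t) * (g * c (U t) t - g * c (V t) t) - k * (U t - V t)\<^sup>2) * exp (- k * t)" for t
  have h: "(h has_real_derivative h' x) (at x within {r..s})" if "x \<in> {r..s}" for x
    unfolding h_def h'_def
    by (rule derivative_eq_intros U[OF that] V[OF that] refl)+ (simp add: algebra_simps power2_eq_square)
  have h'_le: "h' x \<le> 0" if "x \<in> {r..s}" for x
  proof -
    have "(U x - V x) * (g * c (U x) x - g * c (V x) x) = g * ((U x - V x) * (c (U x) x - c (V x) x))"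
      by (simp add: algebra_simps)
    also have "\<dots> \<le> \<bar>g\<bar> * (\<bar>U x - V x\<bar> * \<bar>c (U x) x - c (V x) x\<bar>)"
      unfolding abs_mult[symmetric] by (rule abs_ge_self)
    also have "\<dots> \<le> \<bar>g\<bar> * (\<bar>U x - V x\<bar> * (L * \<bar>U x - V x\<bar>))"
      by (intro mult_left_mono lip that) auto
    also have "\<dots> = \<bar>g\<bar> * L * (U x - V x)\<^sup>2"
      by (simp add: power2_eq_square ac_simps)
    finally have "2 * (U x - V x) * (g * c (U x) x - g * c (V x) x) \<le> k * (U x - V x)\<^sup>2"
      unfolding k_def mult.assoc by linarith
    then show ?thesis by (simp add: h'_def mult_le_0_iff)
  qed
  have "h t \<le> h r"
  proof (rule DERIV_nonpos_imp_decreasing_open[where f = h])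
    show "\<exists>y. (h has_real_derivative y) (at x) \<and> y \<le> 0" if "r < x" "x < t" for x
      using h[of x] h'_le[of x] that t at_within_Icc_at[of r x s] by auto
    show "continuous_on {r..t} h"
      by (rule continuous_on_subset[OF DERIV_continuous_on[OF h]]) (use t in auto)
  qed (use t in auto)
  moreover have "h r = 0" using \<open>U r = V r\<close> by (simp add: h_def)
  moreover have "h t \<ge> 0" by (simp add: h_def)
  ultimately have "h t = 0" by linarith
  then show ?thesis by (simp add: h_def)
qed

text \<open>If g' exceeded g, then V - U would become positive immediately to the right of
  \<open>r\<close>, and at its first return to 0, which must exist because it vanishes at
  \<open>s\<close>, its derivative would again be positive: impossible when approaching 0 from
  above. Used twice with the roles exchanged, this gives g = g'.\<close>

lemma ode_parameter_unique:
  fixes c :: "real \<Rightarrow> real \<Rightarrow> real"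
  assumes U: "\<And>t. t \<in> {r..s} \<Longrightarrow> (U has_real_derivative g * c (U t) t) (at t within {r..s})"
    and V: "\<And>t. t \<in> {r..s} \<Longrightarrow> (V has_real_derivative g' * c (V t) t) (at t within {r..s})"
    and pos: "\<And>t. t \<in> {r..s} \<Longrightarrow> 0 < c (V t) t"
    and "r < s" "U r = V r" "U s = V s"
  shows "g' \<le> g"
proof (rule ccontr)
  assume "\<not> g' \<le> g"
  define D where "D t = V t - U t" for t
  have D: "(D has_real_derivative g' * c (V t) t - g * c (U t) t) (at t within {r..s})" if "t \<in> {r..s}" for t
    unfolding D_def by (intro DERIV_diff U V that)
  have contD: "continuous_on {r..s} D" using D by (rule DERIV_continuous_on)
  \<comment> \<open>At a common value of U and V the graph of V is steeper, so D cannot return to zero.\<close>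
  have D_pos: "g' * c (V t) t - g * c (U t) t > 0" if "D t = 0" "t \<in> {r..s}" for t
  proof -
    have "U t = V t" using that by (simp add: D_def)
    then have "g' * c (V t) t - g * c (U t) t = (g' - g) * c (V t) t" by (simp add: algebra_simps)
    then show ?thesis using pos[OF that(2)] \<open>\<not> g' \<le> g\<close> by simp
  qed
  have "D r = 0" "D s = 0" using assms by (auto simp: D_def)
  have "r \<in> {r..s}" using \<open>r < s\<close> by simp
  from has_real_derivative_pos_inc_right[OF D[OF this] D_pos[OF \<open>D r = 0\<close> this]]
  obtain d where d: "d > 0" "\<And>h. h > 0 \<Longrightarrow> r + h \<in> {r..s} \<Longrightarrow> h < d \<Longrightarrow> D r < D (r + h)" by blast
  \<comment> \<open>A point up to which \<open>D\<close> is known to be positive. Starting the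
    search for zeros here keeps the zero at \<open>r\<close> itself out of \<open>A\<close>.\<close>
  define r' where "r' = r + min (d / 2) (s - r)"
  define A where "A = {t \<in> {r'..s}. D t \<le> 0}"
  have r': "r < r'" "r' \<le> s" "r' < r + d" using d \<open>r < s\<close> by (auto simp: r'_def min_def)
  have pos': "D t > 0" if "r < t" "t \<le> r'" for t
    using d(2)[of "t - r"] that r' \<open>D r = 0\<close> by auto
  have "continuous_on {r'..s} D" by (rule continuous_on_subset[OF contD]) (use r' in auto)
  then have "closed ({r'..s} \<inter> D -` {..0})" by (intro continuous_closed_preimage) auto
  then have "compact ({r'..s} \<inter> ({r'..s} \<inter> D -` {..0}))" by (intro compact_Int_closed) auto
  moreover have "{r'..s} \<inter> ({r'..s} \<inter> D -` {..0}) = A" by (auto simp: A_def)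
  ultimately have "compact A" by simp
  moreover have "A \<noteq> {}" using \<open>D s = 0\<close> r' by (auto simp: A_def)
  ultimately obtain t where t: "t \<in> A" "\<And>x. x \<in> A \<Longrightarrow> t \<le> x"
    using compact_attains_inf[of A] by blast
  have tr: "r' < t" "t \<le> s" using t(1) pos'[of r'] r' by (auto simp: A_def less_le)
  have before: "D x > 0" if "r < x" "x < t" for x
    using pos'[of x] t(2)[of x] that tr by (cases "x \<le> r'") (auto simp: A_def not_le[symmetric])
  \<comment> \<open>A negative value at the first point of \<open>A\<close> would force an earlier
    zero by the intermediate value theorem.\<close>
  have "D t = 0"
  proof (rule ccontr)
    assume "D t \<noteq> 0"
    with t(1) have "D t < 0" by (auto simp: A_def)
    then obtain x where "r' \<le> x" "x \<le> t" "D x = 0"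
      using IVT2'[of D t 0 r'] pos'[of r'] r' tr continuous_on_subset[OF contD, of "{r'..t}"] by auto
    with before[of x] \<open>D t \<noteq> 0\<close> r' show False by (cases "x = t") auto
  qed
  with tr r' D_pos[of t] have "g' * c (V t) t - g * c (U t) t > 0" "t \<in> {r..s}" by auto
  from has_real_derivative_pos_inc_left[OF D[OF this(2)] this(1)]
  obtain e where e: "e > 0" "\<And>h. h > 0 \<Longrightarrow> t - h \<in> {r..s} \<Longrightarrow> h < e \<Longrightarrow> D (t - h) < D t" by blast
  have "min e (t - r) > 0" using e tr r' by simp
  then obtain h where "h > 0" "h < min e (t - r)" by (meson dense)
  then have "h > 0" "h < e" "t - h > r" by auto
  with e(2)[of h] before[of "t - h"] \<open>D t = 0\<close> tr show False by auto
qed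

section \<open>Mixed boundary value problems and boundary normals\<close>

lemma frechet_derivative_cong_open:
  assumes "open S" "x \<in> S" "\<And>y. y \<in> S \<Longrightarrow> f y = g y"
  shows "frechet_derivative f (at x) = frechet_derivative g (at x)"
proof -
  have "(f has_derivative D) (at x) \<longleftrightarrow> (g has_derivative D) (at x)" for D
    using has_derivative_transform_within_open[of f D x UNIV S g]
      has_derivative_transform_within_open[of g D x UNIV S f] assms by auto
  then show ?thesis by (simp add: frechet_derivative_def)
qed

lemma grad_cong_open:
  assumes "open S" "x \<in> S" "\<And>y. y \<in> S \<Longrightarrow> f y = g y"
  shows "grad f x = grad g x"
  using frechet_derivative_cong_open[OF assms] by (simp add: grad_def)

lemma divergence_cong_open:
  assumes "open S" "x \<in> S" "\<And>y. y \<in> S \<Longrightarrow> f y = g y"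
  shows "divergence f x = divergence g x"
  using frechet_derivative_cong_open[OF assms] by (simp add: divergence_def)

lemma grad_inner:
  assumes "(f has_derivative f') (at x)"
  shows "grad f x \<bullet> h = f' h"
proof -
  have lin: "linear f'"
    using assms has_derivative_bounded_linear bounded_linear.linear by blast
  have "f' h = f' (\<Sum>i\<in>Basis. (h \<bullet> i) *\<^sub>R i)" by (simp add: euclidean_representation)
  also have "\<dots> = (\<Sum>i\<in>Basis. (h \<bullet> i) * f' i)"
    by (simp add: linear_sum[OF lin] linear_scale[OF lin])
  also have "\<dots> = grad f x \<bullet> h"
    unfolding grad_def frechet_derivative_at[OF assms, symmetric] inner_sum_left
    by (simp add: inner_commute mult.commute)
  finally show ?thesis by simp
qed

lemma grad_eqI:
  assumes "(f has_derivative (\<lambda>h. g \<bullet> h)) (at x)"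
  shows "grad f x = g"
  by (rule vector_eq_rdot[THEN iffD1]) (simp add: grad_inner[OF assms])

lemma divergence_eq:
  assumes "(V has_derivative D) (at x)"
  shows "divergence V x = (\<Sum>i\<in>Basis. D i \<bullet> i)"
  unfolding divergence_def frechet_derivative_at[OF assms, symmetric] ..

lemma C1_on_cong:
  assumes "C1_on f S" "\<And>x. x \<in> S \<Longrightarrow> g x = f x"
  shows "C1_on g S"
proof -
  obtain D where D: "\<And>x. x \<in> S \<Longrightarrow> (f has_derivative blinfun_apply (D x)) (at x within S)" "continuous_on S D"
    using assms(1) unfolding C1_on_def by blast
  have "(g has_derivative blinfun_apply (D x)) (at x within S)" if "x \<in> S" for x
    by (rule has_derivative_transform[OF that assms(2) D(1)[OF that]])
  with D(2) show ?thesis unfolding C1_on_def by blast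
qed

lemma C1_on_subset:
  assumes "C1_on f S" "T \<subseteq> S"
  shows "C1_on f T"
  using assms unfolding C1_on_def
  by (meson continuous_on_subset has_derivative_subset subsetD)

lemma C1_on_lin:
  assumes "C1_on f S" "C1_on g S"
  shows "C1_on (\<lambda>x. a *\<^sub>R f x + b *\<^sub>R g x) S"
proof -
  obtain D E where
    "\<And>x. x \<in> S \<Longrightarrow> (f has_derivative blinfun_apply (D x)) (at x within S)" "continuous_on S D"
    "\<And>x. x \<in> S \<Longrightarrow> (g has_derivative blinfun_apply (E x)) (at x within S)" "continuous_on S E"
    using assms unfolding C1_on_def by blast
  then show ?thesis
    unfolding C1_on_def
    by (intro exI[of _ "\<lambda>x. a *\<^sub>R D x + b *\<^sub>R E x"])
      (auto intro!: derivative_eq_intros continuous_intros simp: blinfun.bilinear_simps)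
qed

lemma C1_on_const: "C1_on (\<lambda>x. c) S"
  unfolding C1_on_def by (intro exI[of _ "\<lambda>x. 0"]) (auto simp: zero_blinfun.rep_eq)

lemma C1_on_Un_open:
  assumes "open A" "open B" "A \<inter> B = {}" "C1_on f A" "C1_on f B"
  shows "C1_on f (A \<union> B)"
proof -
  obtain D E where D: "\<And>x. x \<in> A \<Longrightarrow> (f has_derivative blinfun_apply (D x)) (at x within A)" "continuous_on A D"
    and E: "\<And>x. x \<in> B \<Longrightarrow> (f has_derivative blinfun_apply (E x)) (at x within B)" "continuous_on B E"
    using assms unfolding C1_on_def by blast
  define DE where "DE x = (if x \<in> A then D x else E x)" for x
  have "continuous_on (A \<union> B) DE"
  proof (rule continuous_on_open_Un[OF assms(1,2)])
    show "continuous_on A DE" using D(2) by (rule continuous_on_eq) (simp add: DE_def)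
    show "continuous_on B DE" using E(2) by (rule continuous_on_eq) (use assms(3) in \<open>auto simp: DE_def\<close>)
  qed
  moreover have "(f has_derivative blinfun_apply (DE x)) (at x within A \<union> B)" if "x \<in> A \<union> B" for x
    using that D(1)[of x] E(1)[of x] assms(3) at_within_open[of x "A \<union> B"] at_within_open[of x A] at_within_open[of x B]
      \<open>open A\<close> \<open>open B\<close> open_Un[OF \<open>open A\<close> \<open>open B\<close>]
    by (auto simp: DE_def)
  ultimately show ?thesis unfolding C1_on_def by blast
qed

lemma C1_on_gradD:
  assumes "C1_on f S" "open S"
  shows "x \<in> S \<Longrightarrow> (f has_derivative (\<lambda>h. grad f x \<bullet> h)) (at x)"
    and "continuous_on S (grad f)"
proof -
  obtain D where D: "\<And>x. x \<in> S \<Longrightarrow> (f has_derivative blinfun_apply (D x)) (at x within S)"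
    and contD: "continuous_on S D"
    using assms unfolding C1_on_def by blast
  have D': "(f has_derivative blinfun_apply (D x)) (at x)" if "x \<in> S" for x
    using D[OF that] at_within_open[OF that \<open>open S\<close>] by simp
  show "(f has_derivative (\<lambda>h. grad f x \<bullet> h)) (at x)" if "x \<in> S" for x
    using D'[OF that] by (simp add: grad_inner[OF D'[OF that]])
  have "continuous_on S (\<lambda>x. \<Sum>i\<in>Basis. D x i *\<^sub>R i)"
    using contD by (intro continuous_intros)
  then show "continuous_on S (grad f)"
    by (rule continuous_on_eq) (simp add: grad_def frechet_derivative_at[OF D', symmetric])
qed

lemma C1_on_gradI:
  assumes "open S" "\<And>x. x \<in> S \<Longrightarrow> (f has_derivative (\<lambda>h. g x \<bullet> h)) (at x)" "continuous_on S g"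
  shows "C1_on f S"
  unfolding C1_on_def
proof (intro exI conjI ballI)
  show "continuous_on S (\<lambda>x. blinfun_inner_right (g x))"
    using assms(3) by (intro continuous_intros)
  show "(f has_derivative blinfun_apply (blinfun_inner_right (g x))) (at x within S)" if "x \<in> S" for x
    using assms(2)[OF that] by (simp add: has_derivative_at_withinI)
qed

text \<open>Regularity and vanishing divergence of the flux are bundled because both pass together
  to linear combinations and across equality on an open set.\<close>

definition div_free :: "('a::euclidean_space \<Rightarrow> 'a) \<Rightarrow> 'a set \<Rightarrow> bool" where
  "div_free V S \<longleftrightarrow> C1_on V S \<and> (\<forall>x\<in>S. divergence V x = 0)"

lemma div_free_cong:
  assumes "open S" "div_free V S" "\<And>x. x \<in> S \<Longrightarrow> W x = V x"
  shows "div_free W S"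
  using assms C1_on_cong[of V S W] divergence_cong_open[of S _ W V] by (auto simp: div_free_def)

lemma div_free_zero: "div_free (\<lambda>x. 0) S"
  by (auto simp: div_free_def C1_on_const divergence_eq[OF has_derivative_const])

lemma div_free_lin:
  assumes "open S" "div_free V S" "div_free W S"
  shows "div_free (\<lambda>x. a *\<^sub>R V x + b *\<^sub>R W x) S"
  unfolding div_free_def
proof (intro conjI ballI)
  show "C1_on (\<lambda>x. a *\<^sub>R V x + b *\<^sub>R W x) S"
    using assms by (intro C1_on_lin) (auto simp: div_free_def)
  fix x assume x: "x \<in> S"
  obtain D E where D: "(V has_derivative D) (at x)" and E: "(W has_derivative E) (at x)"
    using assms x at_within_open[OF x \<open>open S\<close>] unfolding div_free_def C1_on_def by metis
  have "divergence (\<lambda>x. a *\<^sub>R V x + b *\<^sub>R W x) x = a * divergence V x + b * divergence W x"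
    unfolding divergence_eq[OF D] divergence_eq[OF E]
      divergence_eq[OF has_derivative_add[OF has_derivative_scaleR_right[OF D] has_derivative_scaleR_right[OF E]]]
    by (simp add: inner_add_left sum.distrib sum_distrib_left)
  then show "divergence (\<lambda>x. a *\<^sub>R V x + b *\<^sub>R W x) x = 0"
    using assms x by (simp add: div_free_def)
qed

lemma mixed_bvp_iff:
  "mixed_bvp \<Omega> \<Gamma>1 \<Gamma>2 \<Gamma>3 k c1 c2 v \<longleftrightarrow>
     continuous_on (closure \<Omega>) v \<and> C1_on v \<Omega> \<and> div_free (\<lambda>x. k x *\<^sub>R grad v x) \<Omega> \<and>
     (\<forall>x\<in>\<Gamma>1. v x = c1) \<and> (\<forall>x\<in>\<Gamma>2. v x = c2) \<and>
     (\<forall>x\<in>\<Gamma>3. has_normal_derivative \<Omega> v 0 x)"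
  by (auto simp: mixed_bvp_def div_free_def)

text \<open>Along the normal, v may approach its boundary value from above or from below, hence the
  two-sided derivative of \<open>H\<close>.\<close>

lemma has_normal_derivative_compose:
  assumes "has_normal_derivative \<Omega> v d x" "(H has_real_derivative h) (at (v x))"
  shows "has_normal_derivative \<Omega> (\<lambda>x. H (v x)) (h * d) x"
proof -
  obtain n where n: "outward_unit_normal \<Omega> x n"
    "((\<lambda>t. v (x + t *\<^sub>R n)) has_real_derivative d) (at_left 0)"
    using assms(1) unfolding has_normal_derivative_def by blast
  have "((\<lambda>t. H (v (x + t *\<^sub>R n))) has_real_derivative h * d) (at_left 0)"
    using assms(2) n(2) by (intro DERIV_chain'[where g = H]) auto
  with n(1) show ?thesis unfolding has_normal_derivative_def by blast
qed

text \<open>A derivative of \<open>H\<close> within \<open>S\<close> is enough inside the domain,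
  because v maps a neighbourhood of x into \<open>S\<close>. This serves a profile \<open>U\<close>
  that is differentiable only within \<open>{w1..w2}\<close>.\<close>

lemma grad_compose:
  assumes "(v has_derivative (\<lambda>h. g \<bullet> h)) (at x)"
    and "(H has_real_derivative d) (at (v x) within S)"
    and "open T" "x \<in> T" "\<And>y. y \<in> T \<Longrightarrow> v y \<in> S"
  shows "((\<lambda>y. H (v y)) has_derivative (\<lambda>h. (d *\<^sub>R g) \<bullet> h)) (at x)"
proof -
  have "(H has_derivative (*) d) (at (v x) within v ` T)"
    using assms(2,5) by (auto simp: has_field_derivative_def intro: has_derivative_subset)
  then have "((\<lambda>y. H (v y)) has_derivative (\<lambda>h. d * (g \<bullet> h))) (at x within T)"
    by (rule has_derivative_in_compose[OF has_derivative_at_withinI[OF assms(1)]])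
  then show ?thesis using at_within_open[OF assms(4,3)] by simp
qed

text \<open>The flux of H(v) with coefficient k' is
  \<open>(k' x * h (v x)) *\<^sub>R grad v x\<close>. Once this equals a known divergence-free field
  \<open>W\<close>, the equation and the regularity of the flux are inherited from \<open>W\<close>,
  and no derivative of \<open>k'\<close> or \<open>h\<close> is taken. The lemma is used in both
  directions: from \<open>w\<close> to a Laplace problem by Kirchhoff transforms, and from z back to
  \<open>u\<close> and \<open>w\<close>.\<close>

lemma mixed_bvp_compose:
  assumes "open \<Omega>" and v: "mixed_bvp \<Omega> \<Gamma>1 \<Gamma>2 \<Gamma>3 k c1 c2 v"
    and H: "\<And>t. (H has_real_derivative h t) (at t)" and h: "continuous_on UNIV h"
    and W: "div_free W \<Omega>" "\<And>x. x \<in> \<Omega> \<Longrightarrow> (k' x * h (v x)) *\<^sub>R grad v x = W x"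
  shows "mixed_bvp \<Omega> \<Gamma>1 \<Gamma>2 \<Gamma>3 k' (H c1) (H c2) (\<lambda>x. H (v x))"
  unfolding mixed_bvp_iff
proof (intro conjI ballI)
  note v' = v[unfolded mixed_bvp_iff]
  have contH: "continuous_on UNIV H"
    using DERIV_isCont[OF H] by (simp add: continuous_on_eq_continuous_at)
  show "continuous_on (closure \<Omega>) (\<lambda>x. H (v x))"
    by (rule continuous_on_compose2[OF contH]) (use v' in auto)
  have C1v: "C1_on v \<Omega>" using v' by blast
  have der: "((\<lambda>x. H (v x)) has_derivative (\<lambda>d. (h (v x) *\<^sub>R grad v x) \<bullet> d)) (at x)" if "x \<in> \<Omega>" for x
    using grad_compose[OF C1_on_gradD(1)[OF C1v \<open>open \<Omega>\<close> that] H \<open>open \<Omega>\<close> that] by simp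
  show "C1_on (\<lambda>x. H (v x)) \<Omega>"
  proof (rule C1_on_gradI[OF \<open>open \<Omega>\<close> der])
    have "continuous_on \<Omega> v"
      by (rule continuous_on_subset[OF _ closure_subset]) (use v' in blast)
    then have "continuous_on \<Omega> (\<lambda>x. h (v x))"
      by (rule continuous_on_compose2[OF h]) auto
    then show "continuous_on \<Omega> (\<lambda>x. h (v x) *\<^sub>R grad v x)"
      by (intro continuous_on_scaleR C1_on_gradD(2)[OF C1v \<open>open \<Omega>\<close>])
  qed
  show "div_free (\<lambda>x. k' x *\<^sub>R grad (\<lambda>x. H (v x)) x) \<Omega>"
  proof (rule div_free_cong[OF \<open>open \<Omega>\<close> W(1)])
    show "k' x *\<^sub>R grad (\<lambda>x. H (v x)) x = W x" if "x \<in> \<Omega>" for x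
      using W(2)[OF that] by (simp add: grad_eqI[OF der[OF that]])
  qed
  show "has_normal_derivative \<Omega> (\<lambda>x. H (v x)) 0 x" if "x \<in> \<Gamma>3" for x
  proof -
    have "has_normal_derivative \<Omega> v 0 x" using v' that by blast
    from has_normal_derivative_compose[OF this H] show ?thesis by simp
  qed
  show "H (v x) = H c1" if "x \<in> \<Gamma>1" for x using v' that by simp
  show "H (v x) = H c2" if "x \<in> \<Gamma>2" for x using v' that by simp
qed

section \<open>Local geometry of a C^1 boundary: charts, cones and normals\<close>

definition boundary_chart :: "'a::euclidean_space set \<Rightarrow> 'a set \<Rightarrow> ('a \<Rightarrow> real) \<Rightarrow> bool" where
  "boundary_chart \<Omega> V \<phi> \<longleftrightarrow> open V \<and> C1_on \<phi> V \<and> (\<forall>y\<in>V. grad \<phi> y \<noteq> 0) \<and>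
     \<Omega> \<inter> V = {y\<in>V. \<phi> y < 0} \<and> frontier \<Omega> \<inter> V = {y\<in>V. \<phi> y = 0}"

lemma outward_unit_normal_chart:
  "outward_unit_normal \<Omega> x n \<longleftrightarrow>
     x \<in> frontier \<Omega> \<and> (\<exists>V \<phi>. boundary_chart \<Omega> V \<phi> \<and> x \<in> V \<and> n = sgn (grad \<phi> x))"
  unfolding outward_unit_normal_def boundary_chart_def by blast

lemma boundary_chartD:
  assumes "boundary_chart \<Omega> V \<phi>"
  shows "open V" "continuous_on V (grad \<phi>)"
    "y \<in> V \<Longrightarrow> (\<phi> has_derivative (\<lambda>h. grad \<phi> y \<bullet> h)) (at y)" "y \<in> V \<Longrightarrow> grad \<phi> y \<noteq> 0"
    "y \<in> V \<Longrightarrow> y \<in> \<Omega> \<longleftrightarrow> \<phi> y < 0" "y \<in> V \<Longrightarrow> y \<in> frontier \<Omega> \<longleftrightarrow> \<phi> y = 0"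
  using assms C1_on_gradD[of \<phi> V] unfolding boundary_chart_def by blast+

lemma norm_outward_unit_normal: "outward_unit_normal \<Omega> x n \<Longrightarrow> norm n = 1"
  by (auto simp: outward_unit_normal_chart norm_sgn boundary_chartD)

text \<open>The first-order expansion of the defining function at x has the error
  \<open>G * \<delta> * norm h\<close> against the main term \<open>G * (n \<bullet> h)\<close>, so
  off the thin double cone around the tangent hyperplane its sign is that of
  \<open>n \<bullet> h\<close>.\<close>

lemma outward_unit_normal_cone:
  fixes n :: "'a::euclidean_space"
  assumes "outward_unit_normal \<Omega> x n" "\<delta> > 0"
  obtains r where "r > 0"
    "\<And>h. norm h < r \<Longrightarrow> n \<bullet> h < - \<delta> * norm h \<Longrightarrow> x + h \<in> \<Omega>"
    "\<And>h. norm h < r \<Longrightarrow> n \<bullet> h > \<delta> * norm h \<Longrightarrow> x + h \<notin> \<Omega>"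
    "\<And>h. norm h < r \<Longrightarrow> x + h \<in> frontier \<Omega> \<Longrightarrow> \<bar>n \<bullet> h\<bar> \<le> \<delta> * norm h"
proof -
  obtain V \<phi> where chart: "boundary_chart \<Omega> V \<phi>" and V: "x \<in> V" "n = sgn (grad \<phi> x)"
    using assms(1) unfolding outward_unit_normal_chart by blast
  note chart = boundary_chartD[OF chart]
  define G where "G = norm (grad \<phi> x)"
  have G: "G > 0" using chart(4)[OF V(1)] by (simp add: G_def)
  have g: "grad \<phi> x \<bullet> h = G * (n \<bullet> h)" for h
    using G by (simp add: V(2) sgn_div_norm G_def)
  have \<phi>x: "\<phi> x = 0" using assms(1) chart(6)[OF V(1)] by (simp add: outward_unit_normal_chart)
  obtain d where d: "d > 0"
    "\<And>y. norm (y - x) < d \<Longrightarrow> norm (\<phi> y - \<phi> x - grad \<phi> x \<bullet> (y - x)) \<le> (G * \<delta>) * norm (y - x)"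
    using chart(3)[OF V(1)] mult_pos_pos[OF G \<open>\<delta> > 0\<close>] unfolding has_derivative_at_alt by blast
  obtain e where e: "e > 0" "ball x e \<subseteq> V" using chart(1) V(1) openE by blast
  have est: "\<bar>\<phi> (x + h) - G * (n \<bullet> h)\<bar> \<le> G * (\<delta> * norm h)" "x + h \<in> V" if "norm h < min d e" for h
    using d(2)[of "x + h"] e(2) that \<phi>x by (auto simp: g mult.assoc subset_eq dist_norm)
  show ?thesis
  proof (rule that[of "min d e"])
    fix h :: 'a assume h: "norm h < min d e"
    show "x + h \<in> \<Omega>" if "n \<bullet> h < - \<delta> * norm h"
    proof -
      have "G * (n \<bullet> h) < G * (- (\<delta> * norm h))" using mult_strict_left_mono[OF that G] by simp
      then have "\<phi> (x + h) < 0" using est(1)[OF h] by simp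
      then show ?thesis using chart(5)[OF est(2)[OF h]] by blast
    qed
    show "x + h \<notin> \<Omega>" if "n \<bullet> h > \<delta> * norm h"
    proof -
      have "G * (n \<bullet> h) > G * (\<delta> * norm h)" using mult_strict_left_mono[OF that G] by simp
      then have "\<phi> (x + h) > 0" using est(1)[OF h] by simp
      then show ?thesis using chart(5)[OF est(2)[OF h]] by simp
    qed
    show "\<bar>n \<bullet> h\<bar> \<le> \<delta> * norm h" if "x + h \<in> frontier \<Omega>"
    proof -
      have "\<phi> (x + h) = 0" using that chart(6)[OF est(2)[OF h]] by blast
      then have "G * \<bar>n \<bullet> h\<bar> \<le> G * (\<delta> * norm h)" using est(1)[OF h] G by (simp add: abs_mult)
      then show ?thesis using G by simp
    qed
  qed (use d e in auto)
qed

text \<open>If n and n' differ, the direction n - n' points outward with respect to n and inward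
  with respect to n'. A small step in it would end both outside and inside \<Omega>.\<close>

lemma outward_unit_normal_unique:
  assumes n: "outward_unit_normal \<Omega> x n" and n': "outward_unit_normal \<Omega> x n'"
  shows "n = n'"
proof (rule ccontr)
  assume "n \<noteq> n'"
  define d where "d = n - n'"
  have nn: "n \<bullet> n = 1" "n' \<bullet> n' = 1"
    using norm_outward_unit_normal n n' by (metis norm_eq_1)+
  have d0: "norm d > 0" using \<open>n \<noteq> n'\<close> by (simp add: d_def)
  have "d \<bullet> d > 0" using d0 by simp
  then have c: "n \<bullet> d > 0" "n' \<bullet> d = - (n \<bullet> d)"
    using nn by (auto simp: d_def inner_diff inner_commute)
  \<comment> \<open>Half the cosine of the angle between n and d, so that d avoids the tangent cones
    of both normals.\<close>
  define \<delta> where "\<delta> = (n \<bullet> d) / (2 * norm d)"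
  have \<delta>: "\<delta> > 0" "\<delta> * norm d < n \<bullet> d" using c d0 by (auto simp: \<delta>_def)
  obtain r where r: "r > 0" "\<And>h. norm h < r \<Longrightarrow> n \<bullet> h > \<delta> * norm h \<Longrightarrow> x + h \<notin> \<Omega>"
    using outward_unit_normal_cone[OF n \<delta>(1)] by metis
  obtain r' where r': "r' > 0" "\<And>h. norm h < r' \<Longrightarrow> n' \<bullet> h < - \<delta> * norm h \<Longrightarrow> x + h \<in> \<Omega>"
    using outward_unit_normal_cone[OF n' \<delta>(1)] by metis
  define t where "t = min r r' / (2 * norm d)"
  have t: "t > 0" "t * norm d < r" "t * norm d < r'"
    using r(1) r'(1) d0 by (auto simp: t_def)
  have "t * (\<delta> * norm d) < t * (n \<bullet> d)" using \<delta> t by simp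
  then have "x + t *\<^sub>R d \<notin> \<Omega>" "x + t *\<^sub>R d \<in> \<Omega>"
    using r(2)[of "t *\<^sub>R d"] r'(2)[of "t *\<^sub>R d"] t c by (auto simp: algebra_simps)
  then show False by simp
qed

text \<open>Normals at nearby points may come from other charts, but by uniqueness they all equal
  the normalised gradient of the one chart at x, which is continuous.\<close>

lemma outward_unit_normal_continuous:
  assumes n: "outward_unit_normal \<Omega> x n" and "\<delta> > 0"
  obtains r where "r > 0" "\<And>y n'. dist y x < r \<Longrightarrow> outward_unit_normal \<Omega> y n' \<Longrightarrow> dist n' n < \<delta>"
proof -
  obtain V \<phi> where V: "boundary_chart \<Omega> V \<phi>" "x \<in> V" "n = sgn (grad \<phi> x)"
    using n unfolding outward_unit_normal_chart by blast
  note chart = boundary_chartD[OF V(1)]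
  have "continuous_on V (\<lambda>y. sgn (grad \<phi> y))"
    unfolding sgn_div_norm using chart(2,4) by (intro continuous_intros) auto
  then have "isCont (\<lambda>y. sgn (grad \<phi> y)) x"
    using chart(1) V(2) continuous_on_eq_continuous_at by blast
  then obtain d where d: "d > 0" "\<And>y. dist y x < d \<Longrightarrow> dist (sgn (grad \<phi> y)) n < \<delta>"
    using \<open>\<delta> > 0\<close> V(3) unfolding continuous_at_eps_delta by auto
  obtain e where e: "e > 0" "ball x e \<subseteq> V" using chart(1) V(2) openE by blast
  show ?thesis
  proof (rule that[of "min d e"])
    fix y n' assume y: "dist y x < min d e" and n': "outward_unit_normal \<Omega> y n'"
    have "y \<in> V" using y e by (auto simp: dist_commute subset_eq)
    then have "n' = sgn (grad \<phi> y)"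
      using outward_unit_normal_unique[OF n'] n' V(1) unfolding outward_unit_normal_chart by blast
    with d(2)[of y] y show "dist n' n < \<delta>" by simp
  qed (use d e in auto)
qed

text \<open>Near x the gradient of the defining function keeps a positive component along n, so the
  function decreases along -n and stays negative.\<close>

lemma outward_unit_normal_push_inside:
  assumes n: "outward_unit_normal \<Omega> x n"
  obtains r where "r > 0" "\<And>y s. y \<in> \<Omega> \<Longrightarrow> dist y x < r \<Longrightarrow> 0 \<le> s \<Longrightarrow> s < r \<Longrightarrow> y - s *\<^sub>R n \<in> \<Omega>"
proof -
  obtain V \<phi> where V: "boundary_chart \<Omega> V \<phi>" "x \<in> V" "n = sgn (grad \<phi> x)"
    using n unfolding outward_unit_normal_chart by blast
  note chart = boundary_chartD[OF V(1)]
  have "isCont (\<lambda>y. grad \<phi> y \<bullet> n) x"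
    using chart(1,2) V(2) continuous_on_eq_continuous_at by (intro continuous_intros) blast
  moreover have "grad \<phi> x \<bullet> n > 0"
    using chart(4)[OF V(2)] by (simp add: V(3) sgn_div_norm)
  ultimately have "\<forall>\<^sub>F y in at x. grad \<phi> y \<bullet> n > 0"
    unfolding isCont_def by (rule order_tendstoD)
  then obtain d where d: "d > 0" "\<And>y. dist y x < d \<Longrightarrow> grad \<phi> y \<bullet> n > 0"
    using \<open>grad \<phi> x \<bullet> n > 0\<close> unfolding eventually_at by (metis UNIV_I)
  obtain e where e: "e > 0" "ball x e \<subseteq> V" using chart(1) V(2) openE by blast
  have nn: "norm n = 1" using n by (rule norm_outward_unit_normal)
  show ?thesis
  \<comment> \<open>Half the radius for the starting point and half for the shift keep the whole
    segment in the good neighbourhood.\<close>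
  proof (rule that[of "min d e / 2"])
    fix y s assume y: "y \<in> \<Omega>" "dist y x < min d e / 2" and s: "0 \<le> s" "s < min d e / 2"
    have near: "dist (y - t *\<^sub>R n) x < min d e" if "0 \<le> t" "t \<le> s" for t
    proof -
      have "dist (y - t *\<^sub>R n) x \<le> dist (y - t *\<^sub>R n) y + dist y x" by (rule dist_triangle)
      moreover have "dist (y - t *\<^sub>R n) y = t" using that nn by (simp add: dist_norm)
      ultimately show ?thesis using that s y(2) by linarith
    qed
    then have inV: "y - t *\<^sub>R n \<in> V" if "0 \<le> t" "t \<le> s" for t
      using that e(2) by (force simp: dist_commute subset_eq)
    have der: "((\<lambda>t. \<phi> (y - t *\<^sub>R n)) has_real_derivative - (grad \<phi> (y - t *\<^sub>R n) \<bullet> n)) (at t)"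
      if "0 \<le> t" "t \<le> s" for t
    proof -
      have "((\<lambda>t. y - t *\<^sub>R n) has_derivative (\<lambda>d. - (d *\<^sub>R n))) (at t)"
        by (auto intro!: derivative_eq_intros)
      from has_derivative_compose[OF this chart(3)[OF inV[OF that]]] show ?thesis
        unfolding has_field_derivative_def
        by (rule has_derivative_eq_rhs) (simp add: fun_eq_iff)
    qed
    have "\<phi> (y - s *\<^sub>R n) \<le> \<phi> (y - 0 *\<^sub>R n)"
    proof (rule DERIV_nonpos_imp_nonincreasing[OF s(1)])
      show "\<exists>z. ((\<lambda>t. \<phi> (y - t *\<^sub>R n)) has_real_derivative z) (at t) \<and> z \<le> 0"
        if "0 \<le> t" "t \<le> s" for t
        using der[OF that] d(2)[of "y - t *\<^sub>R n"] near[OF that] by (intro exI conjI) auto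
    qed
    moreover have "\<phi> y < 0" using chart(5)[OF inV[of 0]] s(1) y(1) by simp
    ultimately show "y - s *\<^sub>R n \<in> \<Omega>" using chart(5)[OF inV[of s]] s(1) by simp
  qed (use d e in auto)
qed

lemma outward_unit_normal_eventually_inside:
  assumes n: "outward_unit_normal \<Omega> x n"
  shows "\<forall>\<^sub>F t in at_left 0. x + t *\<^sub>R n \<in> \<Omega>"
proof -
  obtain r where r: "r > 0" "\<And>h. norm h < r \<Longrightarrow> n \<bullet> h < - (1/2) * norm h \<Longrightarrow> x + h \<in> \<Omega>"
    using outward_unit_normal_cone[OF n, of "1/2"] by (metis half_gt_zero_iff zero_less_one)
  have nn: "norm n = 1" using n by (rule norm_outward_unit_normal)
  then have "n \<bullet> n = 1" by (simp add: norm_eq_1)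
  with nn r have "x + t *\<^sub>R n \<in> \<Omega>" if "t < 0" "- r < t" for t
    using that by (intro r(2)) auto
  then show ?thesis
    using r(1) by (auto simp: eventually_at_left_field intro!: exI[of _ "- r"])
qed

text \<open>As the closures of T and of its complement are disjoint, the boundary conditions are the
  only obstruction to changing the solution on T alone.\<close>

lemma mixed_bvp_paste:
  assumes "open \<Omega>" "open T" "open (\<Omega> - T)" "T \<subseteq> \<Omega>"
    and sep: "closure T \<inter> closure (\<Omega> - T) = {}"
    and fr: "frontier \<Omega> = \<Gamma>1 \<union> \<Gamma>2 \<union> \<Gamma>3"
    and v: "mixed_bvp \<Omega> \<Gamma>1 \<Gamma>2 \<Gamma>3 (\<lambda>x. 1) c1 c2 v"
    and \<Gamma>1: "\<And>x. x \<in> \<Gamma>1 \<Longrightarrow> x \<in> closure T \<Longrightarrow> \<alpha> * c1 + \<beta> = c1"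
    and \<Gamma>2: "\<And>x. x \<in> \<Gamma>2 \<Longrightarrow> x \<in> closure T \<Longrightarrow> \<alpha> * c2 + \<beta> = c2"
  shows "mixed_bvp \<Omega> \<Gamma>1 \<Gamma>2 \<Gamma>3 (\<lambda>x. 1) c1 c2 (\<lambda>x. if x \<in> closure T then \<alpha> * v x + \<beta> else v x)"
    (is "mixed_bvp _ _ _ _ _ _ _ ?v")
  unfolding mixed_bvp_iff
proof (intro conjI ballI)
  note v' = v[unfolded mixed_bvp_iff]
  have cl: "closure \<Omega> = closure T \<union> closure (\<Omega> - T)"
    using \<open>T \<subseteq> \<Omega>\<close> by (metis Un_Diff_cancel2 closure_Un sup.absorb1 sup.commute)
  have vT: "?v x = \<alpha> * v x + \<beta>" if "x \<in> closure T" for x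
    using that by simp
  have vT': "?v x = v x" if "x \<in> closure (\<Omega> - T)" for x
    using that sep by auto
  have \<Omega>: "\<Omega> = T \<union> (\<Omega> - T)" using \<open>T \<subseteq> \<Omega>\<close> by auto
  show "continuous_on (closure \<Omega>) ?v"
    unfolding cl
  proof (rule continuous_on_closed_Un)
    have "continuous_on (closure T) v" "continuous_on (closure (\<Omega> - T)) v"
      using v' cl by (metis continuous_on_subset sup_ge1, metis continuous_on_subset sup_ge2)
    then have "continuous_on (closure T) (\<lambda>x. \<alpha> * v x + \<beta>)" "continuous_on (closure (\<Omega> - T)) v"
      by (auto intro!: continuous_intros)
    then show "continuous_on (closure T) ?v" "continuous_on (closure (\<Omega> - T)) ?v"
      using vT vT' by (simp_all cong: continuous_on_cong)
  qed auto
  have C1v: "C1_on v \<Omega>" using v' by blast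
  show "C1_on ?v \<Omega>"
    apply (subst \<Omega>)
  proof (rule C1_on_Un_open[OF \<open>open T\<close> \<open>open (\<Omega> - T)\<close>])
    have "C1_on (\<lambda>x. \<alpha> *\<^sub>R v x + \<beta> *\<^sub>R 1) T"
      using C1_on_subset[OF C1v \<open>T \<subseteq> \<Omega>\<close>] by (intro C1_on_lin C1_on_const)
    then show "C1_on ?v T"
      by (rule C1_on_cong) (use closure_subset in auto)
    show "C1_on ?v (\<Omega> - T)"
      by (rule C1_on_cong[OF C1_on_subset[OF C1v Diff_subset] vT'[OF subsetD[OF closure_subset]]])
  qed auto
  have gradT: "grad ?v x = \<alpha> *\<^sub>R grad v x" if "x \<in> T" for x
  proof -
    have "grad ?v x = grad (\<lambda>x. \<alpha> * v x + \<beta>) x"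
      using \<open>open T\<close> that by (rule grad_cong_open) (use closure_subset in auto)
    also have "\<dots> = \<alpha> *\<^sub>R grad v x"
      using C1_on_gradD(1)[OF C1v \<open>open \<Omega>\<close>, of x] that \<open>T \<subseteq> \<Omega>\<close>
      by (intro grad_eqI) (auto intro!: derivative_eq_intros)
    finally show ?thesis .
  qed
  have gradT': "grad ?v x = grad v x" if "x \<in> \<Omega> - T" for x
    using \<open>open (\<Omega> - T)\<close> that by (rule grad_cong_open) (rule vT'[OF subsetD[OF closure_subset]])
  have dv: "div_free (grad v) \<Omega>" using v' by simp
  have dT: "div_free (\<lambda>x. 1 *\<^sub>R grad ?v x) T"
  proof (rule div_free_cong[OF \<open>open T\<close>])
    have "div_free (grad v) T"
      using dv C1_on_subset[of "grad v" \<Omega> T] \<open>T \<subseteq> \<Omega>\<close> by (auto simp: div_free_def)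
    then show "div_free (\<lambda>x. \<alpha> *\<^sub>R grad v x + 0 *\<^sub>R 0) T"
      by (intro div_free_lin \<open>open T\<close> div_free_zero)
  qed (simp add: gradT)
  have dT': "div_free (\<lambda>x. 1 *\<^sub>R grad ?v x) (\<Omega> - T)"
  proof (rule div_free_cong[OF \<open>open (\<Omega> - T)\<close>])
    show "div_free (grad v) (\<Omega> - T)"
      using dv C1_on_subset[of "grad v" \<Omega> "\<Omega> - T"] by (auto simp: div_free_def)
  qed (simp add: gradT')
  have "C1_on (\<lambda>x. 1 *\<^sub>R grad ?v x) (T \<union> (\<Omega> - T))"
    using dT dT' unfolding div_free_def by (intro C1_on_Un_open \<open>open T\<close> \<open>open (\<Omega> - T)\<close>) auto
  then show "div_free (\<lambda>x. 1 *\<^sub>R grad ?v x) \<Omega>"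
    using dT dT' \<Omega>[symmetric] unfolding div_free_def by auto
  show "?v x = c1" if "x \<in> \<Gamma>1" for x using v' that \<Gamma>1[OF that] by auto
  show "?v x = c2" if "x \<in> \<Gamma>2" for x using v' that \<Gamma>2[OF that] by auto
  fix x assume "x \<in> \<Gamma>3"
  then obtain n where n: "outward_unit_normal \<Omega> x n"
    and d: "((\<lambda>t. v (x + t *\<^sub>R n)) has_real_derivative 0) (at_left 0)"
    using v' unfolding has_normal_derivative_def by blast
  have "x \<in> closure \<Omega>" using \<open>x \<in> \<Gamma>3\<close> fr by (auto simp: frontier_def)
  have lim: "((\<lambda>t. x + t *\<^sub>R n) \<longlongrightarrow> x) (at_left 0)"
    by (rule tendsto_eq_intros | simp)+
  \<comment> \<open>Only points of \<Omega> close to x enter the difference quotient. By separation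
    they lie on the same side as x, so the pasted function agrees there with a single
    formula.\<close>
  have "((\<lambda>t. ?v (x + t *\<^sub>R n)) has_real_derivative 0) (at_left 0)"
  proof (cases "x \<in> closure T")
    case True
    then have "x \<in> - closure (\<Omega> - T)" using sep by blast
    then have "\<forall>\<^sub>F t in at_left 0. x + t *\<^sub>R n \<in> - closure (\<Omega> - T)"
      using lim by (intro topological_tendstoD) auto
    then have ev: "\<forall>\<^sub>F t in at_left 0. \<alpha> * v (x + t *\<^sub>R n) + \<beta> = ?v (x + t *\<^sub>R n)"
      using outward_unit_normal_eventually_inside[OF n]
    proof eventually_elim
      case (elim t)
      then have "x + t *\<^sub>R n \<in> closure T" using closure_subset cl by blast
      then show ?case by simp
    qed
    have "((\<lambda>t. \<alpha> * v (x + t *\<^sub>R n) + \<beta>) has_real_derivative 0) (at_left 0)"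
      using d by (auto intro!: derivative_eq_intros)
    then show ?thesis
      using has_field_derivative_cong_eventually[OF ev] True by simp
  next
    case False
    then have "x \<in> - closure T" by blast
    then have "\<forall>\<^sub>F t in at_left 0. x + t *\<^sub>R n \<in> - closure T"
      using lim by (intro topological_tendstoD) auto
    then have ev: "\<forall>\<^sub>F t in at_left 0. v (x + t *\<^sub>R n) = ?v (x + t *\<^sub>R n)"
      by eventually_elim auto
    show ?thesis
      using has_field_derivative_cong_eventually[OF ev] False d by simp
  qed
  with n show "has_normal_derivative \<Omega> ?v 0 x"
    unfolding has_normal_derivative_def by blast
qed

section \<open>The maximum principle\<close>

text \<open>A positive \<open>l\<close> would make f' positive just to the right of 0, and
  \<open>f\<close> would exceed f(0) there by the mean value theorem.\<close>

lemma second_derivative_local_max: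
  fixes f f' :: "real \<Rightarrow> real"
  assumes "r > 0" and f: "\<And>t. \<bar>t\<bar> < r \<Longrightarrow> (f has_real_derivative f' t) (at t)"
    and f': "(f' has_real_derivative l) (at 0)" and max: "\<And>t. \<bar>t\<bar> < r \<Longrightarrow> f t \<le> f 0"
  shows "l \<le> 0"
proof (rule ccontr)
  assume "\<not> l \<le> 0"
  have "f' 0 = 0"
    by (rule DERIV_local_max[OF f \<open>r > 0\<close>]) (use max \<open>r > 0\<close> in auto)
  from DERIV_pos_inc_right[OF f'] \<open>\<not> l \<le> 0\<close> obtain d where
    d: "d > 0" "\<And>h. h > 0 \<Longrightarrow> h < d \<Longrightarrow> f' 0 < f' (0 + h)" by force
  obtain h where h: "0 < h" "h < min d r" using d(1) \<open>r > 0\<close> dense[of 0 "min d r"] by auto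
  obtain t where "0 < t" "t < h" "f h - f 0 = (h - 0) * f' t"
    using MVT2[of 0 h f f'] h f by auto
  with d(2)[of t] \<open>f' 0 = 0\<close> h have "f h - f 0 > 0" by auto
  with max[of h] h show False by auto
qed

lemma derivative_at_left_max:
  fixes f :: "real \<Rightarrow> real"
  assumes "(f has_real_derivative l) (at_left 0)" "\<forall>\<^sub>F t in at_left 0. f t \<le> f 0"
  shows "l \<ge> 0"
proof (rule tendsto_lowerbound)
  show "((\<lambda>t. (f t - f 0) / (t - 0)) \<longlongrightarrow> l) (at_left 0)"
    using assms(1) by (simp add: has_field_derivative_iff)
  have "\<forall>\<^sub>F t in at_left (0::real). t < 0" by (simp add: eventually_at_filter)
  with assms(2) show "\<forall>\<^sub>F t in at_left 0. 0 \<le> (f t - f 0) / (t - 0)"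
    by eventually_elim (auto intro: divide_nonpos_neg)
qed (rule trivial_limit_at_left_real)

text \<open>The linear term fixes the slope along n, the term with \<open>A\<close> pulls the
  function down on small spheres near the hyperplane orthogonal to n, and the term with
  \<open>B\<close> restores a positive Laplacian by adding curvature in the direction n only, where
  it does little harm near that hyperplane.\<close>

definition barrier :: "'a::euclidean_space \<Rightarrow> real \<Rightarrow> real \<Rightarrow> real \<Rightarrow> 'a \<Rightarrow> real" where
  "barrier n \<beta> A B h = \<beta> * (n \<bullet> h) - A * (h \<bullet> h) + B * (n \<bullet> h)\<^sup>2"

lemma continuous_on_barrier [continuous_intros]:
  "continuous_on S f \<Longrightarrow> continuous_on S (\<lambda>x. barrier n \<beta> A B (f x))"
  unfolding barrier_def by (intro continuous_intros)

lemma barrier_has_derivative_line: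
  "((\<lambda>t. barrier n \<beta> A B (h + t *\<^sub>R d)) has_real_derivative
     \<beta> * (n \<bullet> d) - 2 * A * ((h + t *\<^sub>R d) \<bullet> d) + 2 * B * (n \<bullet> (h + t *\<^sub>R d)) * (n \<bullet> d)) (at t within S)"
  unfolding barrier_def inner_add_left inner_add_right inner_scaleR_left inner_scaleR_right
  by (rule derivative_eq_intros refl)+ (simp add: algebra_simps inner_commute)

text \<open>The trace of the Hessian of the barrier is 2 (B - A DIM('a)), so the barrier is strictly
  subharmonic.\<close>

lemma no_local_max_of_perturbation:
  fixes z :: "'a::euclidean_space \<Rightarrow> real" and A B :: real
  assumes "open \<Omega>" "C1_on z \<Omega>" "div_free (grad z) \<Omega>" "x \<in> \<Omega>"
    and "norm n = 1" "A * DIM('a) < B" "\<epsilon> > 0" "r > 0"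
    and max: "\<And>y. y \<in> ball x r \<Longrightarrow>
      z y + \<epsilon> * barrier n \<beta> A B (y - x0) \<le> z x + \<epsilon> * barrier n \<beta> A B (x - x0)"
  shows False
proof -
  obtain e where e: "e > 0" "ball x e \<subseteq> \<Omega>" using \<open>open \<Omega>\<close> \<open>x \<in> \<Omega>\<close> openE by blast
  obtain D where D: "(grad z has_derivative D) (at x)"
    using assms(3) at_within_open[OF \<open>x \<in> \<Omega>\<close> \<open>open \<Omega>\<close>] \<open>x \<in> \<Omega>\<close> unfolding div_free_def C1_on_def by metis
  have D_lin: "D (t *\<^sub>R i) = t *\<^sub>R D i" for t i
    using has_derivative_linear[OF D] linear_scale by blast
  \<comment> \<open>At a local maximum the second derivative along each coordinate axis is
    nonpositive. Summed over the axes, the part from z is the divergence of its gradient, that is 0,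
    and the positive barrier part remains.\<close>
  have le: "D i \<bullet> i + \<epsilon> * (- 2 * A + 2 * B * (n \<bullet> i)\<^sup>2) \<le> 0" if i: "i \<in> Basis" for i
  proof -
    have line: "((\<lambda>t. x + t *\<^sub>R i) has_derivative (\<lambda>s. s *\<^sub>R i)) (at t)" for t
      by (auto intro!: derivative_eq_intros)
    define f where "f t = z (x + t *\<^sub>R i) + \<epsilon> * barrier n \<beta> A B ((x - x0) + t *\<^sub>R i)" for t
    define f' where "f' t = grad z (x + t *\<^sub>R i) \<bullet> i + \<epsilon> * (\<beta> * (n \<bullet> i) - 2 * A * (((x - x0) + t *\<^sub>R i) \<bullet> i)
       + 2 * B * (n \<bullet> ((x - x0) + t *\<^sub>R i)) * (n \<bullet> i))" for t
    have in_ball: "x + t *\<^sub>R i \<in> ball x s" if "\<bar>t\<bar> < s" for t s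
      using that i by (simp add: dist_norm)
    show ?thesis
    proof (rule second_derivative_local_max[where f = f and f' = f'])
      show "min e r > 0" using e \<open>r > 0\<close> by simp
      fix t assume t: "\<bar>t\<bar> < min e r"
      then have "x + t *\<^sub>R i \<in> \<Omega>" using in_ball[of t e] e by auto
      from has_derivative_compose[OF line C1_on_gradD(1)[OF assms(2,1) this]]
      have "((\<lambda>t. z (x + t *\<^sub>R i)) has_real_derivative grad z (x + t *\<^sub>R i) \<bullet> i) (at t)"
        unfolding has_field_derivative_def
        by (rule has_derivative_eq_rhs) (simp add: fun_eq_iff)
      then show "(f has_real_derivative f' t) (at t)"
        unfolding f_def f'_def by (intro DERIV_add DERIV_cmult barrier_has_derivative_line)
      show "f t \<le> f 0"
        using max[OF in_ball[of t r]] t by (simp add: f_def algebra_simps)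
    next
      have "((\<lambda>t. grad z (x + t *\<^sub>R i)) has_derivative (\<lambda>s. D (s *\<^sub>R i))) (at 0)"
        using has_derivative_compose[OF line[of 0]] D by simp
      then have 1: "((\<lambda>t. grad z (x + t *\<^sub>R i) \<bullet> i) has_real_derivative D i \<bullet> i) (at 0)"
        unfolding has_field_derivative_def D_lin
        by (auto intro!: derivative_eq_intros simp: fun_eq_iff)
      have 2: "((\<lambda>t. \<beta> * (n \<bullet> i) - 2 * A * (((x - x0) + t *\<^sub>R i) \<bullet> i)
         + 2 * B * (n \<bullet> ((x - x0) + t *\<^sub>R i)) * (n \<bullet> i)) has_real_derivative - 2 * A + 2 * B * (n \<bullet> i)\<^sup>2) (at 0)"
        unfolding inner_add_left inner_add_right inner_scaleR_left inner_scaleR_right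
        by (rule derivative_eq_intros refl)+ (use i in \<open>simp add: power2_eq_square\<close>)
      show "(f' has_real_derivative D i \<bullet> i + \<epsilon> * (- 2 * A + 2 * B * (n \<bullet> i)\<^sup>2)) (at 0)"
        unfolding f'_def by (rule DERIV_add[OF 1 DERIV_cmult[OF 2]])
    qed
  qed
  have "(\<Sum>i\<in>Basis. D i \<bullet> i + \<epsilon> * (- 2 * A + 2 * B * (n \<bullet> i)\<^sup>2)) \<le> 0"
    using le by (rule sum_nonpos)
  moreover have "(\<Sum>i\<in>Basis. D i \<bullet> i) = 0"
    using divergence_eq[OF D] assms(3) \<open>x \<in> \<Omega>\<close> by (simp add: div_free_def)
  moreover have "(\<Sum>i\<in>Basis. \<epsilon> * (- 2 * A + 2 * B * (n \<bullet> i)\<^sup>2)) = \<epsilon> * (2 * (B - A * DIM('a)))"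
  proof -
    have "(\<Sum>i\<in>Basis. (n \<bullet> i)\<^sup>2) = 1"
      using \<open>norm n = 1\<close> euclidean_inner[of n n] by (simp add: norm_eq_1 power2_eq_square)
    moreover have "(\<Sum>i\<in>Basis. \<epsilon> * (- 2 * A + 2 * B * (n \<bullet> i)\<^sup>2))
        = (\<Sum>i\<in>Basis. (2 * \<epsilon> * B) * (n \<bullet> i)\<^sup>2 - 2 * \<epsilon> * A)"
      by (simp add: algebra_simps)
    moreover have "\<dots> = (2 * \<epsilon> * B) * (\<Sum>i\<in>Basis. (n \<bullet> i)\<^sup>2) - DIM('a) * (2 * \<epsilon> * A)"
      by (simp add: sum_subtractf sum_distrib_left)
    ultimately show ?thesis by (simp add: algebra_simps)
  qed
  ultimately have "\<epsilon> * (2 * (B - A * DIM('a))) \<le> 0"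
    by (simp add: sum.distrib)
  moreover have "\<epsilon> * (2 * (B - A * DIM('a))) > 0" using \<open>\<epsilon> > 0\<close> assms(6) by simp
  ultimately show False by linarith
qed

text \<open>On \<open>E\<close> either v is negative, or z stays below its maximum by a uniform gap.
  Hence a small multiple of v pushes z + \<epsilon> v below z(x0) on all of \<open>E\<close>, while
  at x0 itself nothing changes, so the perturbed maximum lies off \<open>E\<close>.\<close>

lemma perturbed_max:
  fixes z v :: "'a::metric_space \<Rightarrow> real"
  assumes "compact D" "continuous_on D z" "continuous_on D v"
    and x0: "x0 \<in> D" "v x0 = 0" and max: "\<And>x. x \<in> D \<Longrightarrow> z x \<le> z x0"
    and E: "compact E" "E \<subseteq> D" "\<And>x. x \<in> E \<Longrightarrow> z x = z x0 \<Longrightarrow> v x < 0"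
  obtains \<epsilon> x where "\<epsilon> > 0" "x \<in> D - E" "\<And>y. y \<in> D \<Longrightarrow> z y + \<epsilon> * v y \<le> z x + \<epsilon> * v x"
proof -
  have contE: "continuous_on E z" "continuous_on E v"
    using assms(2,3) E(2) by (auto intro: continuous_on_subset)
  \<comment> \<open>The part of \<open>E\<close> where the perturbation does not help. It is compact
    and z is strictly below its maximum there, which yields the gap \<mu>.\<close>
  define C where "C = E \<inter> v -` {0..}"
  have "closed C"
    unfolding C_def
    by (rule continuous_closed_preimage[OF contE(2) compact_imp_closed[OF E(1)] closed_atLeast])
  then have "compact C"
    using compact_Int_closed[OF E(1), of C] by (simp add: C_def Int_absorb1 inf.absorb2)
  obtain V where V: "V > 0" "\<And>x. x \<in> E \<Longrightarrow> v x \<le> V"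
  proof -
    have "bounded (v ` E)" using E(1) contE(2) compact_continuous_image compact_imp_bounded by blast
    then obtain b where "b > 0" "\<And>y. y \<in> v ` E \<Longrightarrow> norm y \<le> b" unfolding bounded_pos by blast
    then show ?thesis by (intro that[of b]) force+
  qed
  obtain \<mu> where \<mu>: "\<mu> > 0" "\<And>x. x \<in> C \<Longrightarrow> z x \<le> z x0 - \<mu>"
  proof (cases "C = {}")
    case False
    have "continuous_on C z" using contE(1) by (rule continuous_on_subset) (auto simp: C_def)
    then obtain c where c: "c \<in> C" "\<And>x. x \<in> C \<Longrightarrow> z x \<le> z c"
      using continuous_attains_sup[OF \<open>compact C\<close> False] by blast
    have "z c \<noteq> z x0" using c(1) E(3)[of c] by (auto simp: C_def)
    moreover have "z c \<le> z x0" using c(1) max E(2) by (auto simp: C_def)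
    ultimately have "z x0 - z c > 0" by simp
    then show ?thesis by (rule that) (use c(2) in simp)
  qed (use that[of 1] in auto)
  define \<epsilon> where "\<epsilon> = \<mu> / (2 * V)"
  have \<epsilon>: "\<epsilon> > 0" "\<epsilon> * V < \<mu>" using \<mu>(1) V(1) by (auto simp: \<epsilon>_def)
  have less: "z x + \<epsilon> * v x < z x0" if x: "x \<in> E" for x
  proof (cases "v x \<ge> 0")
    case True
    then have "z x \<le> z x0 - \<mu>" using \<mu>(2)[of x] x by (simp add: C_def)
    moreover have "\<epsilon> * v x \<le> \<epsilon> * V" using V(2)[OF x] \<epsilon>(1) by simp
    ultimately show ?thesis using \<epsilon>(2) by linarith
  next
    case False
    then have "\<epsilon> * v x < 0" using \<epsilon>(1) by (simp add: mult_pos_neg)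
    with max[of x] x E(2) show ?thesis by auto
  qed
  have "continuous_on D (\<lambda>x. z x + \<epsilon> * v x)" using assms(2,3) by (intro continuous_intros)
  then obtain x where x: "x \<in> D" "\<And>y. y \<in> D \<Longrightarrow> z y + \<epsilon> * v y \<le> z x + \<epsilon> * v x"
    using continuous_attains_sup[OF assms(1)] x0(1) by blast
  have "x \<notin> E" using less[of x] x(2)[OF x0(1)] x0(2) by auto
  with x \<epsilon>(1) show ?thesis by (intro that[of \<epsilon> x]) auto
qed

text \<open>The interior touching-ball argument. A point y near \<open>x1\<close> outside the
  maximum set has a nearest point \<open>x0\<close> in it, and the ball around y through
  \<open>x0\<close> contains no maximum point in its interior. A barrier centred at
  \<open>x0\<close> and rising towards y then moves the maximum of the perturbed function into the
  interior of a small ball, where strict subharmonicity forbids it.\<close>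

lemma open_max_set:
  fixes z :: "'a::euclidean_space \<Rightarrow> real"
  assumes \<Omega>: "open \<Omega>" "C1_on z \<Omega>" "div_free (grad z) \<Omega>" and max: "\<And>x. x \<in> \<Omega> \<Longrightarrow> z x \<le> M"
  shows "open {x \<in> \<Omega>. z x = M}"
  unfolding open_contains_ball
proof
  fix x1 assume x1: "x1 \<in> {x \<in> \<Omega>. z x = M}"
  have contz: "continuous_on \<Omega> z"
    using has_derivative_continuous[OF C1_on_gradD(1)[OF \<Omega>(2,1)]]
    by (simp add: continuous_on_eq_continuous_at[OF \<Omega>(1)])
  obtain \<rho> where \<rho>: "\<rho> > 0" "cball x1 \<rho> \<subseteq> \<Omega>" using x1 \<Omega>(1) open_contains_cball by blast
  \<comment> \<open>Half the radius suffices because \<open>x0\<close> is at least as close to y as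
    \<open>x1\<close> is, hence less than \<rho> from \<open>x1\<close>.\<close>
  have "y \<in> {x \<in> \<Omega>. z x = M}" if y: "y \<in> ball x1 (\<rho> / 2)" for y
  proof (rule ccontr)
    assume "y \<notin> {x \<in> \<Omega>. z x = M}"
    moreover have "y \<in> cball x1 \<rho>" using y \<rho>(1) by auto
    ultimately have "z y \<noteq> M" using \<rho>(2) by auto
    define K where "K = cball x1 \<rho> \<inter> z -` {M}"
    have "continuous_on (cball x1 \<rho>) z" using contz \<rho>(2) by (rule continuous_on_subset)
    then have "closed K" unfolding K_def by (intro continuous_closed_preimage) auto
    moreover have "x1 \<in> K" using x1 \<rho>(1) by (simp add: K_def)
    ultimately obtain x0 where x0: "x0 \<in> K" "\<And>x. x \<in> K \<Longrightarrow> dist y x0 \<le> dist y x"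
      using distance_attains_inf[of K y] by blast
    define R where "R = dist y x0"
    have R: "R > 0" using x0(1) \<open>z y \<noteq> M\<close> by (auto simp: R_def K_def)
    define n where "n = (1 / R) *\<^sub>R (y - x0)"
    have n: "norm n = 1" "y = x0 + R *\<^sub>R n" using R by (auto simp: n_def R_def dist_norm)
    \<comment> \<open>For a maximum point at distance r from \<open>x0\<close>, being at least
      \<open>R\<close> away from y means \<open>2 * (n \<bullet> h) \<le> r\<^sup>2 / R\<close>.
      This choice of \<open>A\<close> makes the quadratic loss at least twice the linear
      gain.\<close>
    define A where "A = 1 / R"
    define B where "B = A * DIM('a) + 1"
    have AB: "A > 0" "B > 0" "A * DIM('a) < B" using R by (auto simp: A_def B_def add_pos_pos)
    have "dist x1 x0 < \<rho>"
      using dist_triangle[of x1 x0 y] x0(2)[OF \<open>x1 \<in> K\<close>] y by (simp add: dist_commute)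
    then have "min (\<rho> - dist x1 x0) (1 / B) > 0" using AB by simp
    then obtain r where r: "r > 0" "r < \<rho> - dist x1 x0" "r < 1 / B"
      using dense[of 0 "min (\<rho> - dist x1 x0) (1 / B)"] by auto
    \<comment> \<open>Keeps the term with \<open>B\<close> below the absolute value of the linear
      term.\<close>
    have Br: "B * r < 1" using r(3) AB by (simp add: field_simps)
    have sub: "cball x0 r \<subseteq> cball x1 \<rho>"
      using r(2) dist_triangle[of x1 _ x0] by (auto simp: subset_eq) (smt (verit) dist_triangle)
    obtain \<epsilon> x where \<epsilon>: "\<epsilon> > 0" and x: "x \<in> cball x0 r - sphere x0 r"
      and le: "\<And>y. y \<in> cball x0 r \<Longrightarrow> z y + \<epsilon> * barrier n 1 A B (y - x0) \<le> z x + \<epsilon> * barrier n 1 A B (x - x0)"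
    proof (rule perturbed_max[where D = "cball x0 r" and E = "sphere x0 r" and z = z
          and v = "\<lambda>x. barrier n 1 A B (x - x0)" and ?x0.0 = x0])
      show "continuous_on (cball x0 r) z" using contz by (rule continuous_on_subset) (use sub \<rho>(2) in blast)
      show "z x \<le> z x0" if "x \<in> cball x0 r" for x
      proof -
        have "x \<in> \<Omega>" using that sub \<rho>(2) by blast
        with max[of x] x0(1) show ?thesis by (simp add: K_def)
      qed
      fix x assume x: "x \<in> sphere x0 r" "z x = z x0"
      define h where "h = x - x0"
      define s where "s = n \<bullet> h"
      have h: "norm h = r" using x(1) by (simp add: h_def dist_norm norm_minus_commute)
      have "x \<in> cball x0 r" using x(1) by simp
      then have "x \<in> K" using x sub x0(1) by (auto simp: K_def)
      then have "R \<le> dist y x" using x0(2) by (simp add: R_def)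
      also have "dist y x = norm (R *\<^sub>R n - h)"
        unfolding dist_norm h_def by (subst n(2)) (simp add: algebra_simps)
      finally have "R\<^sup>2 \<le> (norm (h - R *\<^sub>R n))\<^sup>2"
        using R by (simp add: norm_minus_commute power_mono)
      also have "\<dots> = h \<bullet> h - 2 * R * (n \<bullet> h) + R\<^sup>2 * (n \<bullet> n)"
        unfolding power2_norm_eq_inner by (simp add: inner_diff inner_commute power2_eq_square algebra_simps)
      also have "\<dots> = r\<^sup>2 - 2 * R * s + R\<^sup>2"
        using power2_norm_eq_inner[of h] h n(1) by (simp add: s_def norm_eq_1)
      finally have s: "2 * s \<le> A * r\<^sup>2" using R by (simp add: A_def field_simps)
      have sr: "\<bar>s\<bar> \<le> r" using Cauchy_Schwarz_ineq2[of n h] n(1) h by (simp add: s_def)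
      \<comment> \<open>For positive s the left side is below 2s, which is bounded by the right
        side; for s at most 0 it is nonpositive.\<close>
      have "s + B * s\<^sup>2 < A * r\<^sup>2"
      proof -
        have "B * \<bar>s\<bar> < 1" using mult_left_mono[OF sr, of B] AB Br by linarith
        then have "B * s\<^sup>2 \<le> \<bar>s\<bar>"
          using mult_right_mono[of "B * \<bar>s\<bar>" 1 "\<bar>s\<bar>"] by (simp add: power2_eq_square mult.assoc)
        moreover have "B * s\<^sup>2 < s" if "s > 0"
          using mult_strict_right_mono[OF \<open>B * \<bar>s\<bar> < 1\<close>, of s] that by (simp add: power2_eq_square mult.assoc)
        moreover have "A * r\<^sup>2 > 0" using AB r(1) by simp
        ultimately show ?thesis using s by (cases "s > 0") auto
      qed
      then show "barrier n 1 A B (x - x0) < 0"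
        using h by (simp add: barrier_def h_def[symmetric] s_def power2_norm_eq_inner[symmetric])
    qed (use r in \<open>auto intro!: continuous_intros simp: barrier_def\<close>)
    have "x \<in> ball x0 r" using x by auto
    then obtain e where e: "e > 0" "ball x e \<subseteq> ball x0 r" using openE[OF open_ball] by blast
    show False
    proof (rule no_local_max_of_perturbation[OF \<Omega> _ n(1) AB(3) \<epsilon> e(1)])
      show "x \<in> \<Omega>" using x sub \<rho>(2) by blast
      show "z y + \<epsilon> * barrier n 1 A B (y - x0) \<le> z x + \<epsilon> * barrier n 1 A B (x - x0)" if "y \<in> ball x e" for y
        using le[of y] that e(2) by auto
    qed
  qed
  with \<rho>(1) show "\<exists>e>0. ball x1 e \<subseteq> {x \<in> \<Omega>. z x = M}"
    by (intro exI[of _ "\<rho> / 2"]) auto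
qed

lemma connected_subset_of_clopen:
  assumes "open T" "open (\<Omega> - T)" "connected C" "C \<subseteq> \<Omega>" "x \<in> C" "x \<in> T"
  shows "C \<subseteq> T"
  using connectedD[OF assms(3,1,2)] assms(4-6) by blast

text \<open>At a boundary point with a normal, \<Omega> lies locally on one side in a connected way:
  every nearby point of \<Omega> can be pushed along -n, inside \<Omega>, into one common ball
  \<open>W\<close>. As \<open>T\<close> and \<Omega> - T are open, neither such a segment nor
  \<open>W\<close> can meet both.\<close>

lemma outward_unit_normal_one_side:
  fixes n :: "'a::euclidean_space"
  assumes n: "outward_unit_normal \<Omega> y n" and T: "open T" "open (\<Omega> - T)" "T \<subseteq> \<Omega>"
    and y: "y \<in> closure T" "y \<in> closure (\<Omega> - T)"
  shows False
proof -
  have nn: "norm n = 1" using n by (rule norm_outward_unit_normal)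
  then have nn': "n \<bullet> n = 1" by (simp add: norm_eq_1)
  obtain r1 where r1: "r1 > 0" "\<And>h. norm h < r1 \<Longrightarrow> n \<bullet> h < - (1/2) * norm h \<Longrightarrow> y + h \<in> \<Omega>"
    using outward_unit_normal_cone[OF n, of "1/2"] by (metis half_gt_zero_iff zero_less_one)
  obtain r2 where r2: "r2 > 0"
    "\<And>x s. x \<in> \<Omega> \<Longrightarrow> dist x y < r2 \<Longrightarrow> 0 \<le> s \<Longrightarrow> s < r2 \<Longrightarrow> x - s *\<^sub>R n \<in> \<Omega>"
    using outward_unit_normal_push_inside[OF n] by blast
  \<comment> \<open>A point of \<open>W\<close> is displaced from y by at most 5s/4, with normal
    component below -3s/4. This lies in the inward cone of opening 1/2, since 5s/8 is less than
    3s/4.\<close>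
  define s where "s = min r1 r2 / 4"
  have s: "s > 0" "s * 4 \<le> r1" "s < r2" using r1(1) r2(1) by (auto simp: s_def)
  define W where "W = ball (y - s *\<^sub>R n) (s / 4)"
  have W: "W \<subseteq> \<Omega>"
  proof
    fix p assume "p \<in> W"
    define k where "k = p - (y - s *\<^sub>R n)"
    have k: "norm k < s / 4" using \<open>p \<in> W\<close> by (simp add: k_def W_def dist_norm norm_minus_commute)
    have "\<bar>n \<bullet> k\<bar> \<le> norm k" using Cauchy_Schwarz_ineq2[of n k] nn by simp
    moreover have "norm (k - s *\<^sub>R n) \<le> norm k + s" using norm_triangle_ineq4[of k "s *\<^sub>R n"] nn s(1) by simp
    ultimately have "y + (k - s *\<^sub>R n) \<in> \<Omega>"
      using k s nn' by (intro r1(2)) (auto simp: inner_diff)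
    then show "p \<in> \<Omega>" by (simp add: k_def)
  qed
  have pushW: "x - s *\<^sub>R n \<in> W" if "dist x y < s / 4" for x
    using that by (simp add: W_def dist_norm norm_minus_commute)
  have seg: "connected ((\<lambda>t. x - t *\<^sub>R n) ` {0..s})" "(\<lambda>t. x - t *\<^sub>R n) ` {0..s} \<subseteq> \<Omega>"
    if "x \<in> \<Omega>" "dist x y < s / 4" for x
    using r2(2)[of x] that s by (auto intro!: connected_continuous_image continuous_intros)
  obtain x1 where x1: "x1 \<in> T" "dist x1 y < s / 4"
    using y(1) s(1) unfolding closure_approachable by (metis divide_pos_pos zero_less_numeral)
  obtain x2 where x2: "x2 \<in> \<Omega> - T" "dist x2 y < s / 4"
    using y(2) s(1) unfolding closure_approachable by (metis divide_pos_pos zero_less_numeral)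
  have ends: "x \<in> (\<lambda>t. x - t *\<^sub>R n) ` {0..s}" "x - s *\<^sub>R n \<in> (\<lambda>t. x - t *\<^sub>R n) ` {0..s}" for x
    using s(1) by (auto intro: image_eqI[of _ _ 0])
  have "x1 - s *\<^sub>R n \<in> T"
    using connected_subset_of_clopen[OF T(1,2) seg ends(1), of x1] x1 T(3) ends(2)[of x1] by blast
  then have "W \<subseteq> T"
    using connected_subset_of_clopen[OF T(1,2) _ W pushW[OF x1(2)]] by (simp add: W_def)
  then have "x2 - s *\<^sub>R n \<in> T" using pushW[OF x2(2)] by blast
  then have "x2 \<in> T"
    using connected_subset_of_clopen[OF T(1,2) seg ends(2), of x2] x2 ends(1)[of x2] by blast
  with x2(1) show False by blast
qed


text \<open>No interior ball condition is needed at the boundary maximum: since the normal derivative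
  vanishes at all nearby boundary points, it suffices to perturb by a strictly subharmonic barrier
  with negative normal derivative near the maximum.\<close>

lemma mixed_max_principle:
  fixes \<Omega> :: "'a::euclidean_space set"
  assumes \<Omega>: "open \<Omega>" "bounded \<Omega>" and fr: "frontier \<Omega> = \<Gamma>1 \<union> \<Gamma>2 \<union> \<Gamma>3"
    and z: "mixed_bvp \<Omega> \<Gamma>1 \<Gamma>2 \<Gamma>3 (\<lambda>x. 1) c1 c2 z"
    and uniq: "\<And>z' x. mixed_bvp \<Omega> \<Gamma>1 \<Gamma>2 \<Gamma>3 (\<lambda>x. 1) c1 c2 z' \<Longrightarrow> x \<in> closure \<Omega> \<Longrightarrow> z' x = z x"
    and x: "x \<in> closure \<Omega>"
  shows "z x \<le> max c1 c2"
proof (rule ccontr)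
  assume "\<not> z x \<le> max c1 c2"
  note z' = z[unfolded mixed_bvp_iff, simplified]
  have contz: "continuous_on (closure \<Omega>) z" and C1z: "C1_on z \<Omega>" and divz: "div_free (grad z) \<Omega>"
    using z' by auto
  have compact: "compact (closure \<Omega>)" using \<Omega>(2) by (simp add: compact_closure)
  obtain x0 where x0: "x0 \<in> closure \<Omega>" "\<And>y. y \<in> closure \<Omega> \<Longrightarrow> z y \<le> z x0"
  proof -
    have "closure \<Omega> \<noteq> {}" using x by auto
    from continuous_attains_sup[OF compact this contz] that show ?thesis by auto
  qed
  define M where "M = z x0"
  have M: "c1 < M" "c2 < M" using x0(2)[OF x] \<open>\<not> z x \<le> max c1 c2\<close> by (auto simp: M_def)
  define T where "T = {y \<in> \<Omega>. z y = M}"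
  have "z y \<le> M" if "y \<in> \<Omega>" for y
    using x0(2)[of y] that closure_subset by (auto simp: M_def)
  then have openT: "open T" unfolding T_def by (rule open_max_set[OF \<Omega>(1) C1z divz])
  have "continuous_on \<Omega> z" by (rule continuous_on_subset[OF contz closure_subset])
  then have "open (\<Omega> \<inter> z -` (- {M}))"
    by (rule continuous_open_preimage) (use \<Omega>(1) in auto)
  moreover have "\<Omega> - T = \<Omega> \<inter> z -` (- {M})" by (auto simp: T_def)
  ultimately have openT': "open (\<Omega> - T)" by simp
  have "closed (closure \<Omega> \<inter> z -` {M})" by (rule continuous_closed_preimage[OF contz]) auto
  moreover have "T \<subseteq> closure \<Omega> \<inter> z -` {M}" using closure_subset by (auto simp: T_def)
  ultimately have clT: "closure T \<subseteq> closure \<Omega> \<inter> z -` {M}" by (rule closure_minimal[rotated])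
  have \<Gamma>3: "y \<in> \<Gamma>3" if "y \<in> frontier \<Omega>" "max c1 c2 < z y" for y
  proof -
    have "y \<notin> \<Gamma>1" "y \<notin> \<Gamma>2" using z' that(2) by auto
    with that(1) fr show ?thesis by blast
  qed
  have normal: "\<exists>n. outward_unit_normal \<Omega> y n \<and> ((\<lambda>t. z (y + t *\<^sub>R n)) has_real_derivative 0) (at_left 0)"
    if "y \<in> \<Gamma>3" for y
    using z' that unfolding has_normal_derivative_def by blast
  have fr_eq: "frontier \<Omega> = closure \<Omega> - \<Omega>" using \<Omega>(1) by (simp add: frontier_def interior_open)
  \<comment> \<open>A common closure point would be a boundary point with the value
    \<open>M\<close>, too large for \<Gamma>1 and \<Gamma>2. So it has a normal, and \<Omega> would
    lie on two sides there.\<close>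
  have sep: "closure T \<inter> closure (\<Omega> - T) = {}"
  proof (rule ccontr)
    assume "closure T \<inter> closure (\<Omega> - T) \<noteq> {}"
    then obtain y where y: "y \<in> closure T" "y \<in> closure (\<Omega> - T)" by blast
    have "y \<notin> T" using y(2) openT open_Int_closure_eq_empty[of T "\<Omega> - T"] by blast
    moreover have "y \<notin> \<Omega> - T" using y(1) openT' open_Int_closure_eq_empty[of "\<Omega> - T" T] by blast
    moreover have "y \<in> closure \<Omega>" "z y = M" using y(1) clT by auto
    ultimately have "y \<in> \<Gamma>3" using M by (intro \<Gamma>3) (auto simp: fr_eq)
    then obtain n where "outward_unit_normal \<Omega> y n" using normal by blast
    then show False
      by (rule outward_unit_normal_one_side[OF _ openT openT' _ y]) (auto simp: T_def)
  qed
  \<comment> \<open>The closure of \<open>T\<close> meets neither \<Gamma>1 nor \<Gamma>2, so z may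
    be raised by 1 there. Uniqueness then forces \<open>T\<close> to be empty: the maximum is
    attained on the boundary only.\<close>
  have "mixed_bvp \<Omega> \<Gamma>1 \<Gamma>2 \<Gamma>3 (\<lambda>x. 1) c1 c2 (\<lambda>x. if x \<in> closure T then 1 * z x + 1 else z x)"
  proof (rule mixed_bvp_paste[OF \<Omega>(1) openT openT' _ sep fr z])
    show "1 * c1 + 1 = c1" if "y \<in> \<Gamma>1" "y \<in> closure T" for y using that clT z' M by auto
    show "1 * c2 + 1 = c2" if "y \<in> \<Gamma>2" "y \<in> closure T" for y using that clT z' M by auto
  qed (auto simp: T_def)
  from uniq[OF this] have "y \<notin> T" for y using closure_subset[of T] clT by force
  then have S: "y \<in> frontier \<Omega>" if "y \<in> closure \<Omega>" "z y = M" for y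
    using that by (auto simp: fr_eq T_def)
  have "x0 \<in> \<Gamma>3" using M by (intro \<Gamma>3 S x0(1)) (auto simp: M_def)
  then obtain n where n: "outward_unit_normal \<Omega> x0 n" using normal by blast
  have nn: "norm n = 1" using n by (rule norm_outward_unit_normal)
  \<comment> \<open>With \<open>A\<close> = 1/16 and \<open>B\<close> = \<kappa> the barrier is
    strictly subharmonic. The aperture \<delta> is fixed by \<kappa> \<delta> = 1/32, which keeps
    both the linear and the \<kappa> term below the loss of 1/16 on the sphere, and the \<kappa>
    part of the slope below the main part.\<close>
  define \<kappa> where "\<kappa> = real DIM('a) / 16 + 1"
  define \<delta> where "\<delta> = 1 / (32 * \<kappa>)"
  have \<kappa>: "\<kappa> \<ge> 1" "1 / 16 * real DIM('a) < \<kappa>" by (auto simp: \<kappa>_def)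
  have \<delta>: "\<delta> > 0" "\<kappa> * \<delta> = 1 / 32" "\<delta> \<le> 1 / 32" using \<kappa>(1) by (auto simp: \<delta>_def field_simps)
  obtain r1 where r1: "r1 > 0" "\<And>h. norm h < r1 \<Longrightarrow> x0 + h \<in> frontier \<Omega> \<Longrightarrow> \<bar>n \<bullet> h\<bar> \<le> \<delta> * norm h"
    using outward_unit_normal_cone[OF n \<delta>(1)] by metis
  obtain r2 where r2: "r2 > 0" "\<And>y n'. dist y x0 < r2 \<Longrightarrow> outward_unit_normal \<Omega> y n' \<Longrightarrow> dist n' n < 1/2"
    using outward_unit_normal_continuous[OF n, of "1/2"] by auto
  obtain r3 where r3: "r3 > 0" "\<And>y. y \<in> closure \<Omega> \<Longrightarrow> dist y x0 < r3 \<Longrightarrow> dist (z y) (z x0) < M - max c1 c2"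
    using contz[unfolded continuous_on_iff, rule_format, OF x0(1), of "M - max c1 c2"] M by auto
  obtain r where r: "r > 0" "r < r1" "r < r2" "r < r3"
    using dense[of 0 "min r1 (min r2 r3)"] r1(1) r2(1) r3(1) by auto
  \<comment> \<open>The slope -r makes all three terms of order \<open>r\<^sup>2\<close> at distance
    r, so the constants do not depend on r.\<close>
  let ?v = "\<lambda>y. barrier n (- r) (1 / 16) \<kappa> (y - x0)"
  let ?D = "closure \<Omega> \<inter> cball x0 r" and ?E = "closure \<Omega> \<inter> sphere x0 r"
  obtain \<epsilon> y where \<epsilon>: "\<epsilon> > 0" and y: "y \<in> ?D - ?E"
    and ymax: "\<And>y'. y' \<in> ?D \<Longrightarrow> z y' + \<epsilon> * ?v y' \<le> z y + \<epsilon> * ?v y"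
  proof (rule perturbed_max[where D = ?D and E = ?E and z = z and v = ?v and ?x0.0 = x0])
    show "continuous_on ?D z" using contz by (rule continuous_on_subset) auto
    \<comment> \<open>Points with the maximal value lie on the boundary, hence in the thin tangent
      cone at \<open>x0\<close>. Only there must the barrier be negative.\<close>
    fix y assume y: "y \<in> ?E" "z y = z x0"
    define h where "h = y - x0"
    have h: "norm h = r" using y(1) by (simp add: h_def dist_norm norm_minus_commute)
    have "x0 + h \<in> frontier \<Omega>" using S[of y] y by (simp add: h_def M_def)
    then have nh: "\<bar>n \<bullet> h\<bar> \<le> \<delta> * r" using r1(2)[of h] h r(2) by simp
    then have "(n \<bullet> h)\<^sup>2 \<le> (\<delta> * r)\<^sup>2" using abs_le_square_iff[of "n \<bullet> h" "\<delta> * r"] by simp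
    then have "\<kappa> * (n \<bullet> h)\<^sup>2 \<le> \<kappa> * (\<delta> * r)\<^sup>2" using \<kappa>(1) by (intro mult_left_mono) auto
    also have "\<dots> = (\<kappa> * \<delta>) * \<delta> * r\<^sup>2" by (simp add: power2_eq_square)
    also have "\<dots> \<le> 1 / 32 * (1 / 32) * r\<^sup>2" unfolding \<delta>(2) using \<delta>(1,3) by (intro mult_right_mono mult_left_mono) auto
    finally have 1: "\<kappa> * (n \<bullet> h)\<^sup>2 \<le> 1 / 1024 * r\<^sup>2" by simp
    have "r * (- (n \<bullet> h)) \<le> r * (\<delta> * r)"
      using nh r(1) by (intro mult_left_mono) auto
    also have "\<dots> \<le> r * (1 / 32 * r)" using \<delta> r(1) by (intro mult_left_mono mult_right_mono) auto
    finally have 2: "- r * (n \<bullet> h) \<le> 1 / 32 * r\<^sup>2" by (simp add: power2_eq_square mult.commute)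
    have "h \<bullet> h = r\<^sup>2" using power2_norm_eq_inner[of h] h by simp
    then have "?v y = - r * (n \<bullet> h) - 1 / 16 * r\<^sup>2 + \<kappa> * (n \<bullet> h)\<^sup>2" by (simp add: barrier_def h_def[symmetric])
    moreover have "r\<^sup>2 > 0" using r(1) by simp
    ultimately show "?v y < 0" using 1 2 by linarith
  qed (use x0 r compact in \<open>auto intro!: continuous_intros simp: barrier_def compact_Int_closed\<close>)
  have yball: "y \<in> closure \<Omega>" "y \<in> ball x0 r" using y by auto
  obtain e where e: "e > 0" "ball y e \<subseteq> ball x0 r" using openE[OF open_ball yball(2)] by blast
  show False
  proof (cases "y \<in> \<Omega>")
    case True
    then obtain e' where e': "e' > 0" "ball y e' \<subseteq> \<Omega>" using \<Omega>(1) openE by blast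
    show False
    proof (rule no_local_max_of_perturbation[OF \<Omega>(1) C1z divz True nn \<kappa>(2) \<epsilon>])
      show "min e e' > 0" using e e' by simp
      fix y' assume "y' \<in> ball y (min e e')"
      then have "y' \<in> ball x0 r" "y' \<in> closure \<Omega>" using e(2) e'(2) closure_subset by force+
      then show "z y' + \<epsilon> * ?v y' \<le> z y + \<epsilon> * ?v y" by (intro ymax) auto
    qed
  next
    case False
    then have yfr: "y \<in> frontier \<Omega>" using yball(1) by (simp add: fr_eq)
    have yr: "dist y x0 < r" using yball(2) by (simp add: dist_commute)
    \<comment> \<open>By the choice of \<open>r3\<close>, z is still above both boundary values
      here.\<close>
    have "y \<in> \<Gamma>3"
      using r3(2)[OF yball(1)] yr r(4) by (intro \<Gamma>3 yfr) (auto simp: dist_real_def M_def)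
    then obtain m where m: "outward_unit_normal \<Omega> y m"
      and dz: "((\<lambda>t. z (y + t *\<^sub>R m)) has_real_derivative 0) (at_left 0)" using normal by blast
    have mm: "norm m = 1" using m by (rule norm_outward_unit_normal)
    define h where "h = y - x0"
    have h: "norm h < r" using yr by (simp add: h_def dist_norm)
    have "dist m n < 1 / 2" using r2(2)[OF _ m] yr r(3) by simp
    \<comment> \<open>The square equals 2 - 2 (n . m) for unit vectors, so a distance below 1/2
      gives n . m at least 7/8.\<close>
    then have "(norm (m - n))\<^sup>2 \<le> (1 / 2)\<^sup>2" by (intro power_mono) (auto simp: dist_norm)
    then have nm: "n \<bullet> m \<ge> 7 / 8"
      using nn mm unfolding power2_norm_eq_inner
      by (simp add: inner_diff inner_commute norm_eq_1 power2_eq_square)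
    have nm1: "\<bar>n \<bullet> m\<bar> \<le> 1" using Cauchy_Schwarz_ineq2[of n m] nn mm by simp
    have "\<bar>n \<bullet> h\<bar> \<le> \<delta> * norm h" using r1(2)[of h] h r(2) yfr by (simp add: h_def)
    also have "\<dots> \<le> \<delta> * r" using h \<delta>(1) by simp
    finally have nh: "\<bar>n \<bullet> h\<bar> \<le> \<delta> * r" .
    have hm: "\<bar>h \<bullet> m\<bar> \<le> r" using Cauchy_Schwarz_ineq2[of h m] mm h by simp
    \<comment> \<open>The slope of the barrier along the normal m at y: at most -7r/8 + r/8 + r/16.
      Since z has slope 0 there, the perturbed function would increase when entering
      \<Omega>.\<close>
    define d where "d = - r * (n \<bullet> m) - 2 * (1 / 16) * (h \<bullet> m) + 2 * \<kappa> * (n \<bullet> h) * (n \<bullet> m)"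
    have "((\<lambda>t. barrier n (- r) (1 / 16) \<kappa> (h + t *\<^sub>R m)) has_real_derivative d) (at_left 0)"
      using barrier_has_derivative_line[of n "- r" "1 / 16" \<kappa> h m 0 "{..<0}"] by (simp add: d_def)
    then have "((\<lambda>t. z (y + t *\<^sub>R m) + \<epsilon> * barrier n (- r) (1 / 16) \<kappa> (h + t *\<^sub>R m))
        has_real_derivative 0 + \<epsilon> * d) (at_left 0)"
      by (intro DERIV_add[OF dz] DERIV_cmult)
    moreover have "\<forall>\<^sub>F t in at_left 0. z (y + t *\<^sub>R m) + \<epsilon> * barrier n (- r) (1 / 16) \<kappa> (h + t *\<^sub>R m)
        \<le> z (y + 0 *\<^sub>R m) + \<epsilon> * barrier n (- r) (1 / 16) \<kappa> (h + 0 *\<^sub>R m)"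
    proof -
      have "((\<lambda>t. y + t *\<^sub>R m) \<longlongrightarrow> y) (at_left 0)" by (rule tendsto_eq_intros | simp)+
      then have "\<forall>\<^sub>F t in at_left 0. y + t *\<^sub>R m \<in> ball x0 r"
        using yball(2) by (intro topological_tendstoD) auto
      with outward_unit_normal_eventually_inside[OF m] show ?thesis
      proof eventually_elim
        case (elim t)
        then have "y + t *\<^sub>R m \<in> ?D" using closure_subset by auto
        from ymax[OF this] show ?case by (simp add: h_def algebra_simps)
      qed
    qed
    ultimately have "0 + \<epsilon> * d \<ge> 0" by (rule derivative_at_left_max)
    moreover have "d < 0"
    proof -
      have 1: "r * (n \<bullet> m) \<ge> r * (7 / 8)" using nm r(1) by (intro mult_left_mono) auto
      have "\<kappa> * \<bar>n \<bullet> h\<bar> * \<bar>n \<bullet> m\<bar> \<le> \<kappa> * (\<delta> * r) * 1"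
        using nh nm1 \<kappa>(1) \<delta>(1) r(1) by (intro mult_mono mult_left_mono mult_nonneg_nonneg) auto
      then have "\<bar>\<kappa> * (n \<bullet> h) * (n \<bullet> m)\<bar> \<le> (\<kappa> * \<delta>) * r" using \<kappa>(1) by (simp add: abs_mult)
      then have 2: "\<bar>\<kappa> * (n \<bullet> h) * (n \<bullet> m)\<bar> \<le> 1 / 32 * r" unfolding \<delta>(2) .
      have "d = - (r * (n \<bullet> m)) - 1 / 8 * (h \<bullet> m) + 2 * (\<kappa> * (n \<bullet> h) * (n \<bullet> m))"
        by (simp add: d_def)
      with 1 2 hm r(1) show ?thesis by linarith
    qed
    ultimately show False using \<epsilon> by (simp add: zero_le_mult_iff)
  qed
qed

lemma mixed_bvp_uminus:
  assumes "open \<Omega>" "mixed_bvp \<Omega> \<Gamma>1 \<Gamma>2 \<Gamma>3 (\<lambda>x. 1) c1 c2 z"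
  shows "mixed_bvp \<Omega> \<Gamma>1 \<Gamma>2 \<Gamma>3 (\<lambda>x. 1) (- c1) (- c2) (\<lambda>x. - z x)"
proof (rule mixed_bvp_compose[OF assms, where h = "\<lambda>t. - 1"])
  have "div_free (grad z) \<Omega>" using assms(2) by (simp add: mixed_bvp_iff)
  then show "div_free (\<lambda>x. (- 1) *\<^sub>R grad z x + 0 *\<^sub>R 0) \<Omega>"
    by (intro div_free_lin assms(1) div_free_zero)
qed (auto intro!: derivative_eq_intros)

section \<open>Consequences of well-posedness for the solution z of the mixed problem\<close>

context
  fixes \<Omega> \<Gamma>1 \<Gamma>2 \<Gamma>3 :: "'a::euclidean_space set" and z :: "'a \<Rightarrow> real"
  assumes \<Omega>: "open \<Omega>" "bounded \<Omega>" and fr: "frontier \<Omega> = \<Gamma>1 \<union> \<Gamma>2 \<union> \<Gamma>3"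
    and solvable: "mixed_problem_solvable \<Omega> \<Gamma>1 \<Gamma>2 \<Gamma>3"
    and z: "mixed_bvp \<Omega> \<Gamma>1 \<Gamma>2 \<Gamma>3 (\<lambda>x. 1) 0 1 z"
begin

lemma mixed_problem_unique:
  assumes "mixed_bvp \<Omega> \<Gamma>1 \<Gamma>2 \<Gamma>3 (\<lambda>x. 1) 0 1 z'" "x \<in> closure \<Omega>"
  shows "z' x = z x"
  using solvable z assms unfolding mixed_problem_solvable_def by blast

lemma mixed_problem_range:
  assumes x: "x \<in> closure \<Omega>"
  shows "z x \<in> {0..1}"
proof -
  have "z x \<le> max 0 1"
    by (rule mixed_max_principle[OF \<Omega> fr z _ x]) (rule mixed_problem_unique)
  moreover have "- z x \<le> max (- 0) (- 1)"
  proof (rule mixed_max_principle[OF \<Omega> fr mixed_bvp_uminus[OF \<Omega>(1) z] _ x])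
    fix z' y assume "mixed_bvp \<Omega> \<Gamma>1 \<Gamma>2 \<Gamma>3 (\<lambda>x. 1) (- 0) (- 1) z'" and y: "y \<in> closure \<Omega>"
    from mixed_problem_unique[OF _ y] mixed_bvp_uminus[OF \<Omega>(1) this(1)]
    show "z' y = - z y" by force
  qed
  ultimately show ?thesis by simp
qed

text \<open>An omitted level s cuts \<Omega> into the parts below and above s, whose closures are
  disjoint. Replacing z by 0 on the lower part, or by 1 on the upper part, respects the boundary
  data and gives another solution, so z already has these values.\<close>

lemma mixed_problem_dichotomy:
  assumes "s \<in> {0<..<1}" "\<And>x. x \<in> closure \<Omega> \<Longrightarrow> z x \<noteq> s" and x: "x \<in> closure \<Omega>"
  shows "z x \<in> {0, 1}"
proof -
  note z' = z[unfolded mixed_bvp_iff]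
  have contz: "continuous_on (closure \<Omega>) z" using z' by blast
  then have contz': "continuous_on \<Omega> z" by (rule continuous_on_subset[OF _ closure_subset])
  define T where "T = \<Omega> \<inter> z -` {..<s}"
  have T': "\<Omega> - T = \<Omega> \<inter> z -` {s<..}" using assms(2) closure_subset by (force simp: T_def)
  have "\<Omega> - (\<Omega> - T) = T" by (auto simp: T_def)
  have openT: "open T" "open (\<Omega> - T)"
    unfolding T' unfolding T_def using contz' \<Omega>(1) by (auto intro!: continuous_open_preimage)
  have closed: "closed (closure \<Omega> \<inter> z -` {..s})" "closed (closure \<Omega> \<inter> z -` {s..})"
    using contz by (auto intro!: continuous_closed_preimage)
  have cl: "closure T \<subseteq> closure \<Omega> \<inter> z -` {..s}"
    by (rule closure_minimal[OF _ closed(1)], use closure_subset[of \<Omega>] in \<open>force simp: T_def\<close>)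
  have cl': "closure (\<Omega> - T) \<subseteq> closure \<Omega> \<inter> z -` {s..}"
    unfolding T' by (rule closure_minimal[OF _ closed(2)]) (use closure_subset[of \<Omega>] in force)
  have sep: "closure T \<inter> closure (\<Omega> - T) = {}" using cl cl' assms(2) by fastforce
  have bd: "y \<in> \<Gamma>1 \<Longrightarrow> z y = 0" "y \<in> \<Gamma>2 \<Longrightarrow> z y = 1" for y using z' by auto
  have "mixed_bvp \<Omega> \<Gamma>1 \<Gamma>2 \<Gamma>3 (\<lambda>x. 1) 0 1 (\<lambda>x. if x \<in> closure T then 0 * z x + 0 else z x)"
    using bd cl assms(1) openT
    by (intro mixed_bvp_paste[OF \<Omega>(1) openT _ sep fr z]) (force simp: T_def)+
  from mixed_problem_unique[OF this x] have 0: "z x = 0" if "x \<in> closure T" using that by simp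
  have "mixed_bvp \<Omega> \<Gamma>1 \<Gamma>2 \<Gamma>3 (\<lambda>x. 1) 0 1 (\<lambda>x. if x \<in> closure (\<Omega> - T) then 0 * z x + 1 else z x)"
  proof (rule mixed_bvp_paste[OF \<Omega>(1) openT(2) _ _ _ fr z])
    show "open (\<Omega> - (\<Omega> - T))" "closure (\<Omega> - T) \<inter> closure (\<Omega> - (\<Omega> - T)) = {}"
      unfolding \<open>\<Omega> - (\<Omega> - T) = T\<close> using openT sep by auto
    show "0 * 0 + 1 = (0::real)" if "y \<in> \<Gamma>1" "y \<in> closure (\<Omega> - T)" for y
      using bd(1)[OF that(1)] cl' that(2) assms(1) by auto
  qed auto
  from mixed_problem_unique[OF this x] have 1: "z x = 1" if "x \<in> closure (\<Omega> - T)" using that by simp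
  have "\<Omega> = T \<union> (\<Omega> - T)" by (auto simp: T_def)
  then have "x \<in> closure T \<union> closure (\<Omega> - T)" using x by (metis closure_Un)
  then show ?thesis using 0 1 by blast
qed

text \<open>If \<Gamma>1 were empty, the constant 1 would be a solution and hence equal to z; for
  \<Gamma>2 the same holds with the constant 0.\<close>

lemma mixed_problem_boundary_nonempty:
  assumes x: "x \<in> closure \<Omega>"
  shows "z x \<noteq> 1 \<Longrightarrow> \<Gamma>1 \<noteq> {}" and "z x \<noteq> 0 \<Longrightarrow> \<Gamma>2 \<noteq> {}"
proof -
  have const: "mixed_bvp \<Omega> \<Gamma>1 \<Gamma>2 \<Gamma>3 (\<lambda>x. 1) c c (\<lambda>x. c)" for c :: real
    using mixed_bvp_compose[OF \<Omega>(1) z, of "\<lambda>t. c" "\<lambda>t. 0" "\<lambda>x. 0" "\<lambda>x. 1"] div_free_zero by auto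
  show "\<Gamma>1 \<noteq> {}" if "z x \<noteq> 1"
    using mixed_problem_unique[OF _ x, of "\<lambda>x. 1"] const[of 1] that by (auto simp: mixed_bvp_def)
  show "\<Gamma>2 \<noteq> {}" if "z x \<noteq> 0"
    using mixed_problem_unique[OF _ x, of "\<lambda>x. 0"] const[of 0] that by (auto simp: mixed_bvp_def)
qed

end

section \<open>Functional solutions\<close>

lemma continuous_on_clip2:
  assumes "continuous_on ({l..r} \<times> {l'..r'}) (\<lambda>(x, y). f x y)" "l \<le> r" "l' \<le> r'"
    and "continuous_on S g" "continuous_on S h"
  shows "continuous_on S (\<lambda>x. f (clip l r (g x)) (clip l' r' (h x)))"
proof -
  have "continuous_on S (\<lambda>x. (clip l r (g x), clip l' r' (h x)))"
    using assms(4,5) by (intro continuous_intros)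
  moreover have "(\<lambda>x. (clip l r (g x), clip l' r' (h x))) ` S \<subseteq> {l..r} \<times> {l'..r'}"
    using clip_in[OF assms(2)] clip_in[OF assms(3)] by (simp add: image_subset_iff)
  ultimately show ?thesis using continuous_on_compose2[OF assms(1)] by fastforce
qed

lemma continuous_positive_bounds:
  fixes f :: "real \<Rightarrow> real \<Rightarrow> real"
  assumes "continuous_on ({l..r} \<times> {l'..r'}) (\<lambda>(x, y). f x y)" "l \<le> r" "l' \<le> r'"
    and pos: "\<And>x y. x \<in> {l..r} \<Longrightarrow> y \<in> {l'..r'} \<Longrightarrow> 0 < f x y"
  obtains m K where "m > 0" "\<And>x y. x \<in> {l..r} \<Longrightarrow> y \<in> {l'..r'} \<Longrightarrow> m \<le> f x y \<and> f x y \<le> K"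
proof -
  have comp: "compact ({l..r} \<times> {l'..r'})" "{l..r} \<times> {l'..r'} \<noteq> {}"
    using assms(2,3) by (auto intro: compact_Times)
  obtain p where "p \<in> {l..r} \<times> {l'..r'}" "\<And>q. q \<in> {l..r} \<times> {l'..r'} \<Longrightarrow> (\<lambda>(x, y). f x y) p \<le> (\<lambda>(x, y). f x y) q"
    using continuous_attains_inf[OF comp assms(1)] by auto
  moreover obtain p' where "p' \<in> {l..r} \<times> {l'..r'}" "\<And>q. q \<in> {l..r} \<times> {l'..r'} \<Longrightarrow> (\<lambda>(x, y). f x y) q \<le> (\<lambda>(x, y). f x y) p'"
    using continuous_attains_sup[OF comp assms(1)] by auto
  ultimately show ?thesis
    using pos by (intro that[of "(\<lambda>(x, y). f x y) p" "(\<lambda>(x, y). f x y) p'"]) force+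
qed

lemma C1_on_lipschitz_fst:
  fixes f :: "real \<Rightarrow> real \<Rightarrow> real"
  assumes "C1_on (\<lambda>(x, y). f x y) ({l..r} \<times> {l'..r'})"
  obtains L where "L \<ge> 0" "\<And>x x' y. x \<in> {l..r} \<Longrightarrow> x' \<in> {l..r} \<Longrightarrow> y \<in> {l'..r'} \<Longrightarrow>
    \<bar>f x y - f x' y\<bar> \<le> L * \<bar>x - x'\<bar>"
proof -
  let ?S = "{l..r} \<times> {l'..r'}"
  obtain D where D: "\<And>p. p \<in> ?S \<Longrightarrow> ((\<lambda>(x, y). f x y) has_derivative blinfun_apply (D p)) (at p within ?S)"
    and "continuous_on ?S D" using assms unfolding C1_on_def by blast
  then have "bounded (D ` ?S)"
    by (intro compact_imp_bounded compact_continuous_image compact_Times) auto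
  then obtain L where L: "L > 0" "\<And>p. p \<in> ?S \<Longrightarrow> norm (D p) \<le> L"
    unfolding bounded_pos by blast
  have "\<bar>f x y - f x' y\<bar> \<le> L * \<bar>x - x'\<bar>" if "x \<in> {l..r}" "x' \<in> {l..r}" "y \<in> {l'..r'}" for x x' y
  proof -
    have "norm ((\<lambda>(x, y). f x y) (x, y) - (\<lambda>(x, y). f x y) (x', y)) \<le> L * norm ((x, y) - (x', y))"
      by (rule differentiable_bound[OF _ D])
        (use that L in \<open>auto simp: norm_blinfun.rep_eq[symmetric] intro: convex_Times\<close>)
    then show ?thesis by (simp add: norm_Pair)
  qed
  with L(1) show ?thesis by (intro that[of L]) auto
qed

lemma C1_on_realI:
  fixes f :: "real \<Rightarrow> real"
  assumes "\<And>t. (f has_real_derivative g t) (at t)" "continuous_on UNIV g"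
  shows "C1_on f S"
proof (rule C1_on_subset[OF C1_on_gradI])
  show "(f has_derivative (\<lambda>h. g t \<bullet> h)) (at t)" for t
    using assms(1) by (simp add: has_field_derivative_def inner_real_def)
qed (use assms(2) in auto)

lemma C1_on_realE:
  fixes f :: "real \<Rightarrow> real"
  assumes "C1_on f S"
  obtains g where "\<And>t. t \<in> S \<Longrightarrow> (f has_real_derivative g t) (at t within S)" "continuous_on S g"
proof -
  obtain D where D: "\<And>t. t \<in> S \<Longrightarrow> (f has_derivative blinfun_apply (D t)) (at t within S)" "continuous_on S D"
    using assms unfolding C1_on_def by blast
  have "(f has_real_derivative D t 1) (at t within S)" if "t \<in> S" for t
  proof -
    have "blinfun_apply (D t) = (*) (D t 1)"
    proof
      fix h
      have "blinfun_apply (D t) h = D t (h *\<^sub>R 1)" by simp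
      also have "\<dots> = D t 1 * h" unfolding blinfun.scaleR_right by simp
      finally show "blinfun_apply (D t) h = D t 1 * h" .
    qed
    with D(1)[OF that] show ?thesis by (simp add: has_field_derivative_def)
  qed
  then show ?thesis by (rule that) (use D(2) in \<open>auto intro!: continuous_intros\<close>)
qed

context
  fixes \<Omega> \<Gamma>1 \<Gamma>2 \<Gamma>3 :: "'a::euclidean_space set" and a b :: "real \<Rightarrow> real \<Rightarrow> real"
    and u1 u2 w1 w2 :: real and z :: "'a \<Rightarrow> real"
  assumes \<Omega>: "open \<Omega>" "bounded \<Omega>" and fr: "frontier \<Omega> = \<Gamma>1 \<union> \<Gamma>2 \<union> \<Gamma>3"
    and solvable: "mixed_problem_solvable \<Omega> \<Gamma>1 \<Gamma>2 \<Gamma>3"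
    and z: "mixed_bvp \<Omega> \<Gamma>1 \<Gamma>2 \<Gamma>3 (\<lambda>x. 1) 0 1 z"
    and w12: "w1 < w2" and u12: "u1 \<le> u2"
    and conta: "continuous_on ({u1..u2} \<times> {w1..w2}) (\<lambda>(U, w). a U w)"
    and contb: "continuous_on ({u1..u2} \<times> {w1..w2}) (\<lambda>(U, w). b U w)"
    and C1: "C1_on (\<lambda>(U, w). b U w / a U w) ({u1..u2} \<times> {w1..w2})"
    and pos: "\<And>U w. U \<in> {u1..u2} \<Longrightarrow> w \<in> {w1..w2} \<Longrightarrow> 0 < a U w \<and> 0 < b U w"
begin

text \<open>A coefficient restricted to the graph of \<open>U\<close>. The inner clip extends it
  past \<open>{w1..w2}\<close>; the outer one keeps it defined through rectangle values even where
  \<open>U\<close> leaves \<open>{u1..u2}\<close>, which is not excluded off the range of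
  \<open>w\<close>.\<close>

definition along :: "(real \<Rightarrow> real \<Rightarrow> real) \<Rightarrow> (real \<Rightarrow> real) \<Rightarrow> real \<Rightarrow> real" where
  "along f U t = f (clip u1 u2 (U (clip w1 w2 t))) (clip w1 w2 t)"

lemma along_eq: "t \<in> {w1..w2} \<Longrightarrow> U t \<in> {u1..u2} \<Longrightarrow> along f U t = f (U t) t"
  by (simp add: along_def clip_id)

lemma continuous_on_along:
  assumes "continuous_on ({u1..u2} \<times> {w1..w2}) (\<lambda>(U, w). f U w)" "continuous_on {w1..w2} U"
  shows "continuous_on UNIV (along f U)"
proof -
  have "continuous_on UNIV (\<lambda>t. U (clip w1 w2 t))"
    by (rule continuous_on_compose2[OF assms(2)]) (use clip_in w12 in \<open>auto intro!: continuous_intros\<close>)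
  then show ?thesis
    unfolding along_def by (rule continuous_on_clip2[OF assms(1) u12 less_imp_le[OF w12] _ continuous_on_id])
qed

lemma along_b_pos:
  obtains m where "m > 0" "\<And>U t. m \<le> along b U t"
proof -
  obtain m K where "m > 0" "\<And>x y. x \<in> {u1..u2} \<Longrightarrow> y \<in> {w1..w2} \<Longrightarrow> m \<le> b x y \<and> b x y \<le> K"
    using continuous_positive_bounds[OF contb u12] w12 pos by (metis less_imp_le)
  then show ?thesis
    using clip_in u12 w12 by (intro that[of m]) (auto simp: along_def)
qed

lemma antiderivative_along_b_strict_mono:
  assumes F: "\<And>t. (F has_real_derivative along b U t) (at t)" and "s < t"
  shows "F s < F t"
proof -
  obtain m where m: "m > 0" "\<And>t. m \<le> along b U t" using along_b_pos by metis
  have "m * (t - s) > 0" using m(1) \<open>s < t\<close> by simp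
  then show ?thesis
    using derivative_lower_bound[of F "along b U" m s t] F m(2) \<open>s < t\<close> by simp
qed

lemma antiderivative_along_b_inj:
  assumes F: "\<And>t. (F has_real_derivative along b U t) (at t)" and "F s = F t"
  shows "s = t"
  using antiderivative_along_b_strict_mono[OF F, of s t] antiderivative_along_b_strict_mono[OF F, of t s]
    \<open>F s = F t\<close> by (cases s t rule: linorder_cases) auto

text \<open>Shooting is applied to the clipped quotient, which satisfies the global bounds. The
  solution is monotone between its end values, so it never leaves the rectangle and clipping has no
  effect on it.\<close>

lemma functional_profile_exists:
  "\<exists>U g. continuous_on {w1..w2} U \<and> U w1 = u1 \<and> U w2 = u2 \<and> (\<forall>t\<in>{w1..w2}. U t \<in> {u1..u2} \<and>
    (U has_real_derivative g * (b (U t) t / a (U t) t)) (at t within {w1..w2}))"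
proof -
  define c where "c U t = b (clip u1 u2 U) (clip w1 w2 t) / a (clip u1 u2 U) (clip w1 w2 t)" for U t
  have cl: "clip u1 u2 U \<in> {u1..u2}" "clip w1 w2 t \<in> {w1..w2}" for U t
    using clip_in u12 w12 by auto
  have contc0: "continuous_on ({u1..u2} \<times> {w1..w2}) (\<lambda>(U, w). b U w / a U w)"
    using conta contb pos by (auto intro!: continuous_on_divide simp: case_prod_unfold less_imp_neq[symmetric])
  obtain m K where m: "m > 0"
    and mK: "\<And>x y. x \<in> {u1..u2} \<Longrightarrow> y \<in> {w1..w2} \<Longrightarrow> m \<le> b x y / a x y \<and> b x y / a x y \<le> K"
  proof (rule continuous_positive_bounds[OF contc0 u12])
    show "0 < b x y / a x y" if "x \<in> {u1..u2}" "y \<in> {w1..w2}" for x y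
      using pos[OF that] by simp
  qed (use w12 in auto)
  obtain L where L: "L \<ge> 0" "\<And>x x' y. x \<in> {u1..u2} \<Longrightarrow> x' \<in> {u1..u2} \<Longrightarrow> y \<in> {w1..w2} \<Longrightarrow>
      \<bar>b x y / a x y - b x' y / a x' y\<bar> \<le> L * \<bar>x - x'\<bar>"
    using C1_on_lipschitz_fst[OF C1] by blast
  have contc: "continuous_on UNIV (\<lambda>(U, t). c U t)"
    unfolding c_def case_prod_unfold
    using continuous_on_clip2[OF contc0 u12 less_imp_le[OF w12] continuous_on_fst[OF continuous_on_id] continuous_on_snd[OF continuous_on_id]] .
  have lip: "\<bar>c U t - c V t\<bar> \<le> L * \<bar>U - V\<bar>" for U V t
    using L(2)[OF cl(1)[of U] cl(1)[of V] cl(2)[of t]] mult_left_mono[OF clip_lipschitz L(1), of u1 u2 U V]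
    unfolding c_def by linarith
  have bnd: "m \<le> c U t" "c U t \<le> K" for U t using mK[OF cl] by (auto simp: c_def)
  obtain g U where gU: "g \<ge> 0" "continuous_on {w1..w2} U" "U w1 = u1" "U w2 = u2"
    and U': "\<And>t. t \<in> {w1..w2} \<Longrightarrow> (U has_real_derivative g * c (U t) t) (at t within {w1..w2})"
    using two_point_problem[OF contc bnd(1) m bnd(2) lip L(1) w12 u12] by blast
  have mono: "U s \<le> U t" if "w1 \<le> s" "s \<le> t" "t \<le> w2" for s t
  proof (rule DERIV_nonneg_imp_increasing_open[OF that(2)])
    show "\<exists>y. (U has_real_derivative y) (at x) \<and> 0 \<le> y" if "s < x" "x < t" for x
      using U'[of x] that \<open>w1 \<le> s\<close> \<open>t \<le> w2\<close> at_within_Icc_at[of w1 x w2] gU(1) bnd(1)[of "U x" x] m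
      by (intro exI[of _ "g * c (U x) x"]) auto
    show "continuous_on {s..t} U" by (rule continuous_on_subset[OF gU(2)]) (use that in auto)
  qed
  have range: "U t \<in> {u1..u2}" if "t \<in> {w1..w2}" for t
    using mono[of w1 t] mono[of t w2] that gU by auto
  have "(U has_real_derivative g * (b (U t) t / a (U t) t)) (at t within {w1..w2})" if "t \<in> {w1..w2}" for t
    using U'[OF that] clip_id[OF that] clip_id[OF range[OF that]] by (simp add: c_def)
  with gU range show ?thesis by blast
qed

text \<open>With \<open>F\<close> the antiderivative of b along \<open>U\<close> and
  \<open>G\<close> its inverse, w = G(\<Phi> z) has the flux b grad w = \<Phi> grad z. The profile
  equation then gives u = U(w) the flux a grad u = g \<Phi> grad z.\<close>

lemma functional_solution_exists: "\<exists>u w. functional_solution \<Omega> \<Gamma>1 \<Gamma>2 \<Gamma>3 a b u1 u2 w1 w2 u w"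
proof -
  obtain g U where U: "continuous_on {w1..w2} U" "U w1 = u1" "U w2 = u2"
    and UR: "\<And>t. t \<in> {w1..w2} \<Longrightarrow> U t \<in> {u1..u2}"
    and U': "\<And>t. t \<in> {w1..w2} \<Longrightarrow> (U has_real_derivative g * (b (U t) t / a (U t) t)) (at t within {w1..w2})"
    using functional_profile_exists by blast
  let ?\<beta> = "along b U"
  define \<gamma> where "\<gamma> t = g * (along b U t / along a U t)" for t
  have apos: "along a U t \<noteq> 0" for t
    using pos[of "clip u1 u2 (U (clip w1 w2 t))" "clip w1 w2 t"] clip_in u12 w12
    by (auto simp: along_def less_imp_le dest: less_imp_neq)
  have cont\<beta>: "continuous_on UNIV ?\<beta>" by (rule continuous_on_along[OF contb U(1)])
  then have cont\<gamma>: "continuous_on UNIV \<gamma>"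
    unfolding \<gamma>_def using continuous_on_along[OF conta U(1)] apos by (intro continuous_intros) auto
  \<comment> \<open>\<open>V\<close> continues \<open>U\<close> beyond \<open>{w1..w2}\<close>,
    because the composition lemma asks for a two-sided derivative at every real number.\<close>
  obtain V where V: "\<And>t. (V has_real_derivative \<gamma> t) (at t)" "V w1 = u1"
    using continuous_antiderivative[OF cont\<gamma>] by blast
  have VU: "V t = U t" if t: "t \<in> {w1..w2}" for t
  proof -
    have "\<exists>k. \<forall>t\<in>{w1..w2}. V t - U t = k"
    proof (rule has_field_derivative_zero_constant)
      show "((\<lambda>t. V t - U t) has_real_derivative 0) (at t within {w1..w2})" if "t \<in> {w1..w2}" for t
        using DERIV_diff[OF has_field_derivative_at_within[OF V(1)] U'[OF that]] along_eq[where U = U, OF that UR[OF that]]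
        by (simp add: \<gamma>_def)
    qed auto
    then obtain k where k: "\<And>t. t \<in> {w1..w2} \<Longrightarrow> V t - U t = k" by blast
    have "k = 0" using k[of w1] V(2) U(2) w12 by simp
    with k[OF t] show ?thesis by simp
  qed
  obtain F where F: "\<And>t. (F has_real_derivative ?\<beta> t) (at t)" "F w1 = 0"
    using continuous_antiderivative[OF cont\<beta>] by blast
  obtain m where m: "m > 0" "\<And>t. m \<le> ?\<beta> t" using along_b_pos by metis
  obtain G where FG: "\<And>y. F (G y) = y" and GF: "\<And>x. G (F x) = x"
    and G': "\<And>y. (G has_real_derivative inverse (?\<beta> (G y))) (at y)"
    using antiderivative_inverse[OF F(1) m(2,1)] by blast
  note mono = antiderivative_along_b_strict_mono[OF F(1)]
  define \<Phi> where "\<Phi> = F w2"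
  have \<Phi>: "\<Phi> > 0" using mono[OF w12] F(2) by (simp add: \<Phi>_def)
  have GR: "G y \<in> {w1..w2}" if "y \<in> {0..\<Phi>}" for y
    using mono[of "G y" w1] mono[of w2 "G y"] FG[of y] F(2) that by (force simp: \<Phi>_def)
  define w where "w x = G (\<Phi> * z x)" for x
  define u where "u x = V (w x)" for x
  define h where "h t = inverse (?\<beta> (G (\<Phi> * t))) * \<Phi>" for t
  have h: "((\<lambda>t. G (\<Phi> * t)) has_real_derivative h t) (at t)" for t
    unfolding h_def by (rule DERIV_chain2[OF G']) (auto intro!: derivative_eq_intros)
  have contG: "continuous_on UNIV (\<lambda>t. G (\<Phi> * t))"
    using DERIV_isCont[OF h] by (simp add: continuous_on_eq_continuous_at)
  have \<beta>0: "?\<beta> t \<noteq> 0" for t using m(1) m(2)[of t] by linarith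
  have conth: "continuous_on UNIV h"
    unfolding h_def using \<beta>0 by (intro continuous_intros continuous_on_compose2[OF cont\<beta> contG]) auto
  have wR: "w x \<in> {w1..w2}" if "x \<in> closure \<Omega>" for x
    unfolding w_def using mixed_problem_range[OF \<Omega> fr solvable z that] \<Phi>
    by (intro GR) (auto simp: mult_le_cancel_left1)
  have uR: "u x = U (w x)" "u x \<in> {u1..u2}" if "x \<in> closure \<Omega>" for x
    using VU[OF wR[OF that]] UR[OF wR[OF that]] by (auto simp: u_def)
  have \<beta>x: "?\<beta> (w x) = b (u x) (w x)" "along a U (w x) = a (u x) (w x)" if "x \<in> closure \<Omega>" for x
    using along_eq[where U = U, OF wR[OF that]] uR[OF that] by auto
  have cl: "x \<in> closure \<Omega>" if "x \<in> \<Omega>" for x using that closure_subset by blast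
  have dz: "div_free (\<lambda>x. k *\<^sub>R grad z x) \<Omega>" for k
  proof -
    have "div_free (grad z) \<Omega>" using z by (simp add: mixed_bvp_iff)
    from div_free_lin[OF \<Omega>(1) this div_free_zero, of k 0] show ?thesis by simp
  qed
  have bw: "mixed_bvp \<Omega> \<Gamma>1 \<Gamma>2 \<Gamma>3 (\<lambda>x. b (u x) (w x)) w1 w2 w"
  proof -
    have "mixed_bvp \<Omega> \<Gamma>1 \<Gamma>2 \<Gamma>3 (\<lambda>x. b (u x) (w x)) (G (\<Phi> * 0)) (G (\<Phi> * 1)) (\<lambda>x. G (\<Phi> * z x))"
    proof (rule mixed_bvp_compose[OF \<Omega>(1) z h conth dz[of \<Phi>]])
      show "(b (u x) (w x) * h (z x)) *\<^sub>R grad z x = \<Phi> *\<^sub>R grad z x" if "x \<in> \<Omega>" for x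
        using \<beta>x(1)[OF cl[OF that]] \<beta>0[of "w x"] by (simp add: h_def w_def[symmetric])
    qed
    moreover have "G (\<Phi> * 0) = w1" "G (\<Phi> * 1) = w2" using GF[of w1] GF[of w2] F(2) by (auto simp: \<Phi>_def)
    ultimately show ?thesis by (simp add: w_def[abs_def])
  qed
  have au: "mixed_bvp \<Omega> \<Gamma>1 \<Gamma>2 \<Gamma>3 (\<lambda>x. a (u x) (w x)) u1 u2 u"
  proof -
    have "mixed_bvp \<Omega> \<Gamma>1 \<Gamma>2 \<Gamma>3 (\<lambda>x. a (u x) (w x)) (V (G (\<Phi> * 0))) (V (G (\<Phi> * 1))) (\<lambda>x. V (G (\<Phi> * z x)))"
    proof (rule mixed_bvp_compose[OF \<Omega>(1) z, where h = "\<lambda>t. \<gamma> (G (\<Phi> * t)) * h t"])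
      show "((\<lambda>t. V (G (\<Phi> * t))) has_real_derivative \<gamma> (G (\<Phi> * t)) * h t) (at t)" for t
        by (rule DERIV_chain2[OF V(1) h])
      show "continuous_on UNIV (\<lambda>t. \<gamma> (G (\<Phi> * t)) * h t)"
        by (intro continuous_on_mult conth continuous_on_compose2[OF cont\<gamma> contG]) auto
      show "div_free (\<lambda>x. (g * \<Phi>) *\<^sub>R grad z x) \<Omega>" by (rule dz)
      show "(a (u x) (w x) * (\<gamma> (G (\<Phi> * z x)) * h (z x))) *\<^sub>R grad z x = (g * \<Phi>) *\<^sub>R grad z x" if "x \<in> \<Omega>" for x
        using \<beta>x[OF cl[OF that]] \<beta>0[of "w x"] apos[of "w x"] by (simp add: h_def \<gamma>_def w_def[symmetric])
    qed
    moreover have "V (G (\<Phi> * 0)) = u1" "V (G (\<Phi> * 1)) = u2"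
      using GF[of w1] GF[of w2] F(2) V(2) VU[of w2] U w12 by (auto simp: \<Phi>_def)
    ultimately show ?thesis by (simp add: u_def[abs_def] w_def)
  qed
  have "C1_on V {w1..w2}" by (rule C1_on_realI[OF V(1) cont\<gamma>])
  then have "functional_solution \<Omega> \<Gamma>1 \<Gamma>2 \<Gamma>3 a b u1 u2 w1 w2 u w"
    unfolding functional_solution_def classical_solution_def using bw au wR uR(2)
    by (auto simp: u_def intro!: exI[of _ V])
  then show ?thesis by blast
qed

text \<open>\<open>F\<close> and \<open>P\<close> are the transforms for the second and the first
  equation. Both turn \<open>w\<close> into a function with divergence-free gradient and zero normal
  derivative on \<Gamma>3, so any combination with end values 0 and 1 equals z. The condition on
  \<open>U t\<close> is kept because \<open>U\<close> may leave \<open>{u1..u2}\<close> off the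
  range of \<open>w\<close>.\<close>

lemma functional_solution_kirchhoff:
  assumes sol: "classical_solution \<Omega> \<Gamma>1 \<Gamma>2 \<Gamma>3 a b u1 u2 w1 w2 u w"
    and U: "C1_on U {w1..w2}" and Ux: "\<forall>x\<in>closure \<Omega>. u x = U (w x)"
    and F: "\<And>t. (F has_real_derivative along b U t) (at t)" "F w1 = 0"
  shows "x \<in> closure \<Omega> \<Longrightarrow> F (w x) = F w2 * z x"
    and "\<exists>P g. \<forall>x\<in>closure \<Omega>. \<forall>t\<in>{w1..w2}.
      P (w x) = g * F (w x) \<and> (U t \<in> {u1..u2} \<longrightarrow>
        (\<exists>d. (U has_real_derivative d) (at t within {w1..w2}) \<and> (P has_real_derivative a (U t) t * d) (at t)))"
proof -
  have U2: "u x = U (w x)" if "x \<in> closure \<Omega>" for x using Ux that by blast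
  note sol = sol[unfolded classical_solution_def]
  obtain U' where U': "\<And>t. t \<in> {w1..w2} \<Longrightarrow> (U has_real_derivative U' t) (at t within {w1..w2})"
    and contU': "continuous_on {w1..w2} U'" using U by (rule C1_on_realE) blast
  have contU: "continuous_on {w1..w2} U" using U' by (rule DERIV_continuous_on)
  have cl: "x \<in> closure \<Omega>" if "x \<in> \<Omega>" for x using that closure_subset by blast
  have wR: "w x \<in> {w1..w2}" "U (w x) \<in> {u1..u2}" if "x \<in> closure \<Omega>" for x
    using sol U2[OF that] that by auto
  define p where "p t = along a U t * U' (clip w1 w2 t)" for t
  have contp: "continuous_on UNIV p"
    unfolding p_def using w12 clip_in
    by (intro continuous_on_mult continuous_on_along conta contU continuous_on_compose2[OF contU'] continuous_on_clip) auto
  obtain P where P: "\<And>t. (P has_real_derivative p t) (at t)" "P w1 = 0"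
    using continuous_antiderivative[OF contp] by blast
  define \<Phi> where "\<Phi> = F w2"
  have \<Phi>: "\<Phi> > 0"
    using antiderivative_along_b_strict_mono[OF F(1) w12] F(2) by (simp add: \<Phi>_def)
  have flux_w: "along b U (w x) *\<^sub>R grad w x = b (u x) (w x) *\<^sub>R grad w x" if "x \<in> \<Omega>" for x
    using wR[OF cl[OF that]] U2[OF cl[OF that]] by (simp add: along_eq)
  have C1w: "C1_on w \<Omega>" using sol by (auto simp: mixed_bvp_def)
  have flux_u: "p (w x) *\<^sub>R grad w x = a (u x) (w x) *\<^sub>R grad u x" if "x \<in> \<Omega>" for x
  proof -
    have "grad u x = grad (\<lambda>y. U (w y)) x"
      using \<Omega>(1) that U2 cl by (intro grad_cong_open[of \<Omega>]) auto
    also have "\<dots> = U' (w x) *\<^sub>R grad w x"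
      using that wR cl \<Omega>(1)
      by (intro grad_eqI grad_compose[OF C1_on_gradD(1)[OF C1w \<Omega>(1) that] U', of \<Omega>]) auto
    finally show ?thesis
      using wR[OF cl[OF that]] U2[OF cl[OF that]] by (simp add: p_def along_eq clip_id)
  qed
  \<comment> \<open>Allowing both transforms avoids a division by \<open>P w2\<close>, which may be
    0.\<close>
  have comb: "s * F (w x) + r * P (w x) = z x" if "s * \<Phi> + r * P w2 = 1" and x: "x \<in> closure \<Omega>" for s r x
  proof -
    have "mixed_bvp \<Omega> \<Gamma>1 \<Gamma>2 \<Gamma>3 (\<lambda>x. 1) (s * F w1 + r * P w1) (s * F w2 + r * P w2) (\<lambda>x. s * F (w x) + r * P (w x))"
    proof (rule mixed_bvp_compose[where v = w and ?c1.0 = w1 and ?c2.0 = w2 and H = "\<lambda>t. s * F t + r * P t"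
          and h = "\<lambda>t. s * along b U t + r * p t" and k = "\<lambda>x. b (u x) (w x)" and W = "\<lambda>x. s *\<^sub>R (b (u x) (w x) *\<^sub>R grad w x) + r *\<^sub>R (a (u x) (w x) *\<^sub>R grad u x)", OF \<Omega>(1)])
      show "mixed_bvp \<Omega> \<Gamma>1 \<Gamma>2 \<Gamma>3 (\<lambda>x. b (u x) (w x)) w1 w2 w" using sol by blast
      show "((\<lambda>t. s * F t + r * P t) has_real_derivative s * along b U t + r * p t) (at t)" for t
        by (intro DERIV_add DERIV_cmult F(1) P(1))
      show "continuous_on UNIV (\<lambda>t. s * along b U t + r * p t)"
        using continuous_on_along[OF contb contU] contp by (intro continuous_intros)
      show "div_free (\<lambda>x. s *\<^sub>R (b (u x) (w x) *\<^sub>R grad w x) + r *\<^sub>R (a (u x) (w x) *\<^sub>R grad u x)) \<Omega>"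
        using sol by (intro div_free_lin \<Omega>(1)) (auto simp: mixed_bvp_iff)
      show "(1 * (s * along b U (w x) + r * p (w x))) *\<^sub>R grad w x
          = s *\<^sub>R (b (u x) (w x) *\<^sub>R grad w x) + r *\<^sub>R (a (u x) (w x) *\<^sub>R grad u x)" if "x \<in> \<Omega>" for x
        unfolding flux_w[OF that, symmetric] flux_u[OF that, symmetric] by (simp add: algebra_simps)
    qed
    then show ?thesis
      using that F(2) P(2) mixed_problem_unique[OF \<Omega> fr solvable z _ x] by (simp add: \<Phi>_def)
  qed
  have Fz: "F (w x) = \<Phi> * z x" if "x \<in> closure \<Omega>" for x
    using comb[of "1 / \<Phi>" 0, OF _ that] \<Phi> by (simp add: field_simps)
  then show "x \<in> closure \<Omega> \<Longrightarrow> F (w x) = F w2 * z x" by (simp add: \<Phi>_def)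
  define g where "g = P w2 / \<Phi>"
  have Pg: "P (w x) = g * F (w x)" if "x \<in> closure \<Omega>" for x
  proof -
    \<comment> \<open>Coefficients with end value 1 that contain \<open>P\<close> with a nonzero
      weight. Subtracting the representation of z by \<open>F\<close> alone leaves P(w) = g
      F(w).\<close>
    have "((1 - g) / \<Phi>) * \<Phi> + 1 / \<Phi> * P w2 = 1" using \<Phi> by (simp add: g_def field_simps)
    from comb[OF this that] Fz[OF that] \<Phi> show ?thesis by (simp add: field_simps)
  qed
  show "\<exists>P g. \<forall>x\<in>closure \<Omega>. \<forall>t\<in>{w1..w2}.
      P (w x) = g * F (w x) \<and> (U t \<in> {u1..u2} \<longrightarrow>
        (\<exists>d. (U has_real_derivative d) (at t within {w1..w2}) \<and> (P has_real_derivative a (U t) t * d) (at t)))"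
  proof (rule exI[of _ P], rule exI[of _ g], intro ballI conjI impI)
    fix t assume t: "t \<in> {w1..w2}" "U t \<in> {u1..u2}"
    then have "(P has_real_derivative a (U t) t * U' t) (at t)"
      using P(1)[of t] by (simp add: p_def along_eq clip_id)
    with U'[OF t(1)] show "\<exists>d. (U has_real_derivative d) (at t within {w1..w2}) \<and> (P has_real_derivative a (U t) t * d) (at t)"
      by blast
  qed (use Pg in auto)
qed

text \<open>A value of z other than 1 guarantees a point of \<Gamma>1, and one other than 0 a point
  of \<Gamma>2; the end values of \<open>U\<close> are read off there.\<close>

lemma functional_solution_ends:
  assumes sol: "classical_solution \<Omega> \<Gamma>1 \<Gamma>2 \<Gamma>3 a b u1 u2 w1 w2 u w"
    and U: "\<forall>x\<in>closure \<Omega>. u x = U (w x)" and x: "x \<in> closure \<Omega>"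
  shows "z x \<noteq> 1 \<Longrightarrow> U w1 = u1 \<and> w1 \<in> w ` closure \<Omega>" and "z x \<noteq> 0 \<Longrightarrow> U w2 = u2 \<and> w2 \<in> w ` closure \<Omega>"
proof -
  have bd: "\<Gamma>1 \<subseteq> closure \<Omega>" "\<Gamma>2 \<subseteq> closure \<Omega>" using fr by (auto simp: frontier_def)
  note sol = sol[unfolded classical_solution_def mixed_bvp_def]
  show "U w1 = u1 \<and> w1 \<in> w ` closure \<Omega>" if ne: "z x \<noteq> 1"
  proof -
    obtain y where y: "y \<in> \<Gamma>1" using mixed_problem_boundary_nonempty(1)[OF \<Omega> fr solvable z x ne] by blast
    then have "u y = u1" "w y = w1" "y \<in> closure \<Omega>" using sol bd by auto
    with U show ?thesis by auto
  qed
  show "U w2 = u2 \<and> w2 \<in> w ` closure \<Omega>" if ne: "z x \<noteq> 0"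
  proof -
    obtain y where y: "y \<in> \<Gamma>2" using mixed_problem_boundary_nonempty(2)[OF \<Omega> fr solvable z x ne] by blast
    then have "u y = u2" "w y = w2" "y \<in> closure \<Omega>" using sol bd by auto
    with U show ?thesis by auto
  qed
qed

text \<open>When z attains every level in (0,1), \<open>w\<close> is onto \<open>{w1..w2}\<close>.
  The relation P = g F then holds on the whole interval and may be differentiated, giving a U' = g
  b.\<close>

lemma functional_profile_ode:
  assumes sol: "classical_solution \<Omega> \<Gamma>1 \<Gamma>2 \<Gamma>3 a b u1 u2 w1 w2 u w"
    and U: "C1_on U {w1..w2}" and Ux: "\<forall>x\<in>closure \<Omega>. u x = U (w x)"
    and att: "\<forall>s\<in>{0<..<1}. s \<in> z ` closure \<Omega>"
  shows "\<exists>g. \<forall>t\<in>{w1..w2}. U t \<in> {u1..u2} \<and>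
      (U has_real_derivative g * (b (U t) t / a (U t) t)) (at t within {w1..w2})"
    and "U w1 = u1" "U w2 = u2"
proof -
  have U2: "u x = U (w x)" if "x \<in> closure \<Omega>" for x using Ux that by blast
  have "(1 / 2 :: real) \<in> z ` closure \<Omega>" by (rule bspec[OF att]) auto
  then obtain x0 where x0: "x0 \<in> closure \<Omega>" "z x0 = 1 / 2" by force
  note ends = functional_solution_ends[OF sol Ux x0(1)]
  show "U w1 = u1" "U w2 = u2" using ends x0(2) by auto
  obtain F where F: "\<And>t. (F has_real_derivative along b U t) (at t)" "F w1 = 0"
    using continuous_antiderivative[OF continuous_on_along[OF contb], of U w1 0] U
    by (metis C1_on_realE DERIV_continuous_on)
  note strict = antiderivative_along_b_strict_mono[OF F(1)]
  note K = functional_solution_kirchhoff[OF sol U Ux F]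
  have full: "t \<in> w ` closure \<Omega>" if t: "t \<in> {w1..w2}" for t
  proof (cases "t = w1 \<or> t = w2")
    case True
    then show ?thesis using ends x0(2) by auto
  next
    case False
    then have "0 < F t" "F t < F w2" using strict[of w1 t] strict[of t w2] F(2) t by auto
    then have "F t / F w2 \<in> {0<..<1}" by simp
    then obtain x where x: "x \<in> closure \<Omega>" "z x = F t / F w2" using att by force
    then have "F (w x) = F t" using K(1)[OF x(1)] \<open>0 < F t\<close> \<open>F t < F w2\<close> by simp
    then have "w x = t" using antiderivative_along_b_inj F(1) by blast
    with x(1) show ?thesis by blast
  qed
  have UR: "U t \<in> {u1..u2}" if t: "t \<in> {w1..w2}" for t
  proof -
    obtain x where x: "x \<in> closure \<Omega>" "t = w x" using full[OF t] by blast
    have "u x \<in> {u1..u2}" using sol x(1) by (simp add: classical_solution_def)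
    with U2[OF x(1)] x(2) show ?thesis by simp
  qed
  obtain P g where P: "\<And>x. x \<in> closure \<Omega> \<Longrightarrow> P (w x) = g * F (w x)"
    and P': "\<And>t. t \<in> {w1..w2} \<Longrightarrow> \<exists>d. (U has_real_derivative d) (at t within {w1..w2}) \<and> (P has_real_derivative a (U t) t * d) (at t)"
    using K(2) UR x0(1) w12 by (metis atLeastAtMost_iff less_imp_le order_refl)
  have PF: "P t = g * F t" if "t \<in> {w1..w2}" for t using full[OF that] P by auto
  have "(U has_real_derivative g * (b (U t) t / a (U t) t)) (at t within {w1..w2})" if t: "t \<in> {w1..w2}" for t
  proof -
    obtain d where d: "(U has_real_derivative d) (at t within {w1..w2})" "(P has_real_derivative a (U t) t * d) (at t)"
      using P'[OF t] by blast
    have "((\<lambda>t. g * F t) has_real_derivative g * b (U t) t) (at t within {w1..w2})"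
      using DERIV_cmult[OF has_field_derivative_at_within[OF F(1)]] along_eq[where U = U, OF t UR[OF t]] by metis
    moreover have "((\<lambda>t. g * F t) has_real_derivative a (U t) t * d) (at t within {w1..w2})"
      by (rule has_field_derivative_transform_within[OF has_field_derivative_at_within[OF d(2)] zero_less_one t])
        (rule PF)
    \<comment> \<open>Derivatives within a nondegenerate closed interval are unique, also at its end
      points.\<close>
    ultimately have "g * b (U t) t = a (U t) t * d"
      using t w12 vector_derivative_unique_within_closed_interval[of w1 w2 t "\<lambda>t. g * F t"]
      by (auto simp: has_real_derivative_iff_has_vector_derivative)
    then have "d = g * (b (U t) t / a (U t) t)" using pos[OF UR[OF t] t] by (simp add: field_simps)
    with d(1) show ?thesis by simp
  qed
  with UR show "\<exists>g. \<forall>t\<in>{w1..w2}. U t \<in> {u1..u2} \<and>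
      (U has_real_derivative g * (b (U t) t / a (U t) t)) (at t within {w1..w2})" by blast
qed

lemma functional_solution_unique:
  assumes sol: "functional_solution \<Omega> \<Gamma>1 \<Gamma>2 \<Gamma>3 a b u1 u2 w1 w2 u w"
    and sol': "functional_solution \<Omega> \<Gamma>1 \<Gamma>2 \<Gamma>3 a b u1 u2 w1 w2 u' w'"
    and x: "x \<in> closure \<Omega>"
  shows "u x = u' x \<and> w x = w' x"
proof -
  obtain U where cs: "classical_solution \<Omega> \<Gamma>1 \<Gamma>2 \<Gamma>3 a b u1 u2 w1 w2 u w"
    and U: "C1_on U {w1..w2}" and Ux: "\<forall>x\<in>closure \<Omega>. u x = U (w x)"
    using sol unfolding functional_solution_def by blast
  obtain V where cs': "classical_solution \<Omega> \<Gamma>1 \<Gamma>2 \<Gamma>3 a b u1 u2 w1 w2 u' w'"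
    and V: "C1_on V {w1..w2}" and Vx: "\<forall>x\<in>closure \<Omega>. u' x = V (w' x)"
    using sol' unfolding functional_solution_def by blast
  have ex: "\<exists>F. (\<forall>t. (F has_real_derivative along b U t) (at t)) \<and> F w1 = 0" if "C1_on U {w1..w2}" for U
    using continuous_antiderivative[OF continuous_on_along[OF contb], of U w1 0] that
    by (metis C1_on_realE DERIV_continuous_on)
  show ?thesis
  proof (cases "\<forall>s\<in>{0<..<1}. s \<in> z ` closure \<Omega>")
    \<comment> \<open>Now z is 0 or 1 at x, so F(w x) is \<open>F w1\<close> or \<open>F w2\<close>.
      This determines \<open>w x\<close>, and the end values of the profile determine
      \<open>u x\<close>.\<close>
    case False
    have val: "w x = (if z x = 0 then w1 else w2) \<and> u x = (if z x = 0 then u1 else u2)"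
      if cs: "classical_solution \<Omega> \<Gamma>1 \<Gamma>2 \<Gamma>3 a b u1 u2 w1 w2 u w"
        and U: "C1_on U {w1..w2}" and Ux: "\<forall>x\<in>closure \<Omega>. u x = U (w x)" for u w U
    proof -
      obtain F where F: "\<And>t. (F has_real_derivative along b U t) (at t)" "F w1 = 0" using ex[OF U] by blast
      have "z x \<in> {0, 1}" using False mixed_problem_dichotomy[OF \<Omega> fr solvable z _ _ x] by blast
      moreover have "F (w x) = F w2 * z x" by (rule functional_solution_kirchhoff(1)[OF cs U Ux F x])
      ultimately have "w x = (if z x = 0 then w1 else w2)"
        using antiderivative_along_b_inj[OF F(1)] F(2) by auto
      with functional_solution_ends[OF cs Ux x] Ux x \<open>z x \<in> {0, 1}\<close> show ?thesis by auto
    qed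
    from val[OF cs U Ux] val[OF cs' V Vx] show ?thesis by simp
  next
    case True
    let ?c = "\<lambda>x t. b x t / a x t"
    obtain g where g: "\<And>t. t \<in> {w1..w2} \<Longrightarrow> U t \<in> {u1..u2}"
      "\<And>t. t \<in> {w1..w2} \<Longrightarrow> (U has_real_derivative g * ?c (U t) t) (at t within {w1..w2})"
      using functional_profile_ode(1)[OF cs U Ux True] by blast
    obtain g' where g': "\<And>t. t \<in> {w1..w2} \<Longrightarrow> V t \<in> {u1..u2}"
      "\<And>t. t \<in> {w1..w2} \<Longrightarrow> (V has_real_derivative g' * ?c (V t) t) (at t within {w1..w2})"
      using functional_profile_ode(1)[OF cs' V Vx True] by blast
    have ends: "U w1 = V w1" "U w2 = V w2"
      using functional_profile_ode(2,3)[OF cs U Ux True] functional_profile_ode(2,3)[OF cs' V Vx True] by auto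
    have cpos: "0 < ?c (U t) t" "0 < ?c (V t) t" if "t \<in> {w1..w2}" for t
      using pos[OF g(1)[OF that] that] pos[OF g'(1)[OF that] that] by auto
    have "g' \<le> g"
      by (rule ode_parameter_unique[where c = ?c, OF _ _ _ w12 ends]) (erule g(2) g'(2) cpos(2))+
    moreover have "g \<le> g'"
      by (rule ode_parameter_unique[where c = ?c, OF _ _ _ w12 ends[symmetric]]) (erule g(2) g'(2) cpos(1))+
    ultimately have "g = g'" by simp
    obtain L where L: "L \<ge> 0" "\<And>x x' y. x \<in> {u1..u2} \<Longrightarrow> x' \<in> {u1..u2} \<Longrightarrow> y \<in> {w1..w2} \<Longrightarrow>
        \<bar>?c x y - ?c x' y\<bar> \<le> L * \<bar>x - x'\<bar>"
      using C1_on_lipschitz_fst[OF C1] by blast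
    have UV: "U t = V t" if "t \<in> {w1..w2}" for t
    proof (rule ode_unique[where c = ?c and g = g and U = U and V = V and L = L and r = w1 and s = w2 and t = t, OF _ _ _ ends(1) that])
      show "(V has_real_derivative g * ?c (V t) t) (at t within {w1..w2})" if "t \<in> {w1..w2}" for t
        using g'(2)[OF that] \<open>g = g'\<close> by simp
      show "\<bar>?c (U t) t - ?c (V t) t\<bar> \<le> L * \<bar>U t - V t\<bar>" if "t \<in> {w1..w2}" for t
        by (rule L(2)[OF g(1)[OF that] g'(1)[OF that] that])
    qed (erule g(2))
    \<comment> \<open>\<open>along\<close> sees a profile only on \<open>{w1..w2}\<close>, so both
      solutions share the same transform \<open>F\<close>; its injectivity turns the common value
      \<open>F w2 * z x\<close> into w x = w' x.\<close>
    then have "along b U = along b V"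
      using clip_in[of w1 w2] w12 by (auto simp: fun_eq_iff along_def)
    obtain F where F: "\<And>t. (F has_real_derivative along b U t) (at t)" "F w1 = 0" using ex[OF U] by blast
    have "F (w x) = F (w' x)"
      using functional_solution_kirchhoff(1)[OF cs U Ux F x]
        functional_solution_kirchhoff(1)[OF cs' V Vx F[unfolded \<open>along b U = along b V\<close>] x] by simp
    then have "w x = w' x" using antiderivative_along_b_inj F(1) by blast
    moreover have "w x \<in> {w1..w2}" using cs x by (simp add: classical_solution_def)
    ultimately show ?thesis using Ux Vx x UV by simp
  qed
qed

end

theorem theorem2p8:
  fixes \<Omega> \<Gamma>1 \<Gamma>2 \<Gamma>3 :: "'a::euclidean_space set"
    and a b :: "real \<Rightarrow> real \<Rightarrow> real"
    and p q :: "real \<Rightarrow> real"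
    and u1 u2 w1 w2 :: real
  assumes "open \<Omega>" and "bounded \<Omega>"
    and "frontier \<Omega> = \<Gamma>1 \<union> \<Gamma>2 \<union> \<Gamma>3"
    and "\<Gamma>1 \<inter> \<Gamma>2 = {}" and "\<Gamma>1 \<inter> \<Gamma>3 = {}" and "\<Gamma>2 \<inter> \<Gamma>3 = {}"
    and "mixed_problem_solvable \<Omega> \<Gamma>1 \<Gamma>2 \<Gamma>3"
    and "w1 < w2" and "u1 \<le> u2"
    and "continuous_on ({u1..u2} \<times> {w1..w2}) (\<lambda>(U, w). a U w)"
    and "continuous_on ({u1..u2} \<times> {w1..w2}) (\<lambda>(U, w). b U w)"
    and "C1_on (\<lambda>(U, w). b U w / a U w) ({u1..u2} \<times> {w1..w2})"
    and "\<forall>U\<in>{u1..u2}. \<forall>w\<in>{w1..w2}. a U w > 0 \<and> b U w > 0"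
    and "p absolutely_integrable_on {w1..w2}" and "q absolutely_integrable_on {w1..w2}"
    and "AE w in lebesgue. w \<in> {w1..w2} \<longrightarrow>
           (\<forall>U\<in>{u1..u2}. 0 \<le> p w \<and> p w \<le> b U w / a U w \<and> b U w / a U w \<le> q w)"
    and "integral {w1..w2} p > 0"
  shows "(\<exists>u w. functional_solution \<Omega> \<Gamma>1 \<Gamma>2 \<Gamma>3 a b u1 u2 w1 w2 u w) \<and>
         ((\<exists>L. \<forall>w\<in>{w1..w2}. L-lipschitz_on {u1..u2} (\<lambda>U. b U w / a U w)) \<longrightarrow>
          (\<forall>u w u' w'.
             functional_solution \<Omega> \<Gamma>1 \<Gamma>2 \<Gamma>3 a b u1 u2 w1 w2 u w \<longrightarrow>
             functional_solution \<Omega> \<Gamma>1 \<Gamma>2 \<Gamma>3 a b u1 u2 w1 w2 u' w' \<longrightarrow>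
             (\<forall>x\<in>closure \<Omega>. u x = u' x \<and> w x = w' x)))"
proof -
  obtain z where z: "mixed_bvp \<Omega> \<Gamma>1 \<Gamma>2 \<Gamma>3 (\<lambda>x. 1) 0 1 z"
    using assms(7) unfolding mixed_problem_solvable_def by blast
  have pos: "0 < a U w \<and> 0 < b U w" if "U \<in> {u1..u2}" "w \<in> {w1..w2}" for U w
    using assms(13) that by blast
  note hyps = assms(1-3,7) z assms(8-12)
  show ?thesis
    using functional_solution_exists[OF hyps] functional_solution_unique[OF hyps] pos by blast
qed

end
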